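(* There exist sequences of Boolean functions $(f^{(i)}_n)_{n\ge1}$, $1\le i\le 3$, such that as $n\to\infty$, $$\frac{\ell(f^{(1)}_n,\pi_{1/2})}{w(f^{(1)}_n,\pi_{1/2})}\to\infty,\qquad \frac{w(f^{(2)}_n,\pi_{1/2})}{b(f^{(2)}_n,\pi_{1/2})}\to\infty,\qquad \frac{b(f^{(3)}_n,\pi_{1/2})}{s(f^{(3)}_n,\pi_{1/2})}\to\infty.$$
   Context: A Boolean function is a function $f:\{0,1\}^N\to\{0,1\}$ for some $N$ (the number of bits may vary along the sequences). $[N]=\{1,\dots,N\}$. $\pi_{1/2}$ is the uniform measure on $\{0,1\}^N$. For $B\subseteq[N]$, $x^B$ is $x$ with all bits in $B$ flipped, and $x^i=x^{\{i\}}$. For $W\subseteq [N]$, $x|_W$ "determines $f$" if $f$ is constant on $\{y:y|_W=x|_W\}$. - $\ell(f,\pi_{1/2})$ (local witness complexity): consider random sets $\mathcal I\subseteq[N]$ defined on the same probability space as $x\sim\pi_{1/2}$ (not necessarily measurable with respect to $x$; the probability space is arbitrary). $\mathcal I$ is a witness set for $f$ if $x|_{\mathcal I}$ almost surely determines $f$. $\mathcal I$ is local if for every fixed $J\subseteq[N]$, $\sigma(\{\mathcal I=J\},(x_i:i\in J))$ is independent of $\sigma(x_i:i\notin J)$. $\ell(f,\pi_{1/2})$ is the minimum of $\mathbb E[|\mathcal I|]$ over all local witness sets $\mathcal I$ for $f$. - $w(f,\pi_{1/2})=\mathbb E_{x\sim\pi_{1/2}}[w_f(x)]$, where $w_f(x)$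 is the minimum of $|W|$ over $W\subseteq[N]$ such that $x|_W$ determines $f$. - $b(f,\pi_{1/2})=\mathbb E_{x\sim\pi_{1/2}}[b_f(x)]$, where $b_f(x)$ is the maximum number $m$ of disjoint blocks $B_1,\dots,B_m\subseteq[N]$ with $f(x^{B_i})\ne f(x)$ for all $i$. - $s(f,\pi_{1/2})=\mathbb E_{x\sim\pi_{1/2}}[s_f(x)]$, where $s_f(x)$ is the number of bits $i$ with $f(x^i)\ne f(x)$. *)

theory Defs
  imports "HOL-Probability.Probability"
begin

text \<open>A point of \<open>{0,1}\<^sup>N\<close> is an extensional function on \<open>{1..N}\<close>, and a Boolean function on \<open>N\<close>
  bits is a map on \<^typ>\<open>nat \<Rightarrow> bool\<close> of which only the values on \<open>bitcube N\<close> are ever used.\<close>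

type_synonym bits = "nat \<Rightarrow> bool"

definition bitcube :: "nat \<Rightarrow> bits set" where
  "bitcube N = {1..N} \<rightarrow>\<^sub>E UNIV"

definition pi_half :: "nat \<Rightarrow> bits measure" where
  "pi_half N = uniform_count_measure (bitcube N)"

definition flip_bits :: "nat set \<Rightarrow> bits \<Rightarrow> bits" where
  "flip_bits B x = (\<lambda>i. if i \<in> B then \<not> x i else x i)"

definition determines :: "nat \<Rightarrow> (bits \<Rightarrow> bool) \<Rightarrow> nat set \<Rightarrow> bits \<Rightarrow> bool" where
  "determines N f W x \<longleftrightarrow> f constant_on {y \<in> bitcube N. restrict y W = restrict x W}"


subsection \<open>Witness complexity, block sensitivity and sensitivity\<close>

definition witness_at :: "nat \<Rightarrow> (bits \<Rightarrow> bool) \<Rightarrow> bits \<Rightarrow> nat" where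
  "witness_at N f x = Min {card W | W. W \<subseteq> {1..N} \<and> determines N f W x}"

text \<open>A block whose flip changes the value is nonempty, so disjoint such blocks are distinct and can
  be collected in a set.\<close>

definition block_sens_at :: "nat \<Rightarrow> (bits \<Rightarrow> bool) \<Rightarrow> bits \<Rightarrow> nat" where
  "block_sens_at N f x =
     Max {card \<B> | \<B>. \<B> \<subseteq> Pow {1..N} \<and> disjoint \<B> \<and> (\<forall>B\<in>\<B>. f (flip_bits B x) \<noteq> f x)}"

definition sens_at :: "nat \<Rightarrow> (bits \<Rightarrow> bool) \<Rightarrow> bits \<Rightarrow> nat" where
  "sens_at N f x = card {i \<in> {1..N}. f (flip_bits {i} x) \<noteq> f x}"

definition witness_compl :: "nat \<Rightarrow> (bits \<Rightarrow> bool) \<Rightarrow> real" where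
  "witness_compl N f = (\<integral>x. real (witness_at N f x) \<partial>pi_half N)"

definition block_sens :: "nat \<Rightarrow> (bits \<Rightarrow> bool) \<Rightarrow> real" where
  "block_sens N f = (\<integral>x. real (block_sens_at N f x) \<partial>pi_half N)"

definition sens :: "nat \<Rightarrow> (bits \<Rightarrow> bool) \<Rightarrow> real" where
  "sens N f = (\<integral>x. real (sens_at N f x) \<partial>pi_half N)"


subsection \<open>Local witness complexity\<close>

definition random_input_and_set ::
    "nat \<Rightarrow> 'a measure \<Rightarrow> ('a \<Rightarrow> bits) \<Rightarrow> ('a \<Rightarrow> nat set) \<Rightarrow> bool" where
  "random_input_and_set N M X I \<longleftrightarrow>
     prob_space M \<and>
     X \<in> M \<rightarrow>\<^sub>M count_space (bitcube N) \<and> distr M (count_space (bitcube N)) X = pi_half N \<and>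
     I \<in> M \<rightarrow>\<^sub>M count_space (Pow {1..N})"

definition witness_set ::
    "nat \<Rightarrow> (bits \<Rightarrow> bool) \<Rightarrow> 'a measure \<Rightarrow> ('a \<Rightarrow> bits) \<Rightarrow> ('a \<Rightarrow> nat set) \<Rightarrow> bool" where
  "witness_set N f M X I \<longleftrightarrow> (AE \<omega> in M. determines N f (I \<omega>) (X \<omega>))"

definition local_set ::
    "nat \<Rightarrow> 'a measure \<Rightarrow> ('a \<Rightarrow> bits) \<Rightarrow> ('a \<Rightarrow> nat set) \<Rightarrow> bool" where
  "local_set N M X I \<longleftrightarrow>
     (\<forall>J\<subseteq>{1..N}. prob_space.indep_set M
        (sigma_sets (space M)
           (insert {\<omega> \<in> space M. I \<omega> = J} {{\<omega> \<in> space M. X \<omega> i} | i. i \<in> J}))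
        (sigma_sets (space M) {{\<omega> \<in> space M. X \<omega> i} | i. i \<in> {1..N} - J}))"

definition local_witness_set ::
    "nat \<Rightarrow> (bits \<Rightarrow> bool) \<Rightarrow> 'a measure \<Rightarrow> ('a \<Rightarrow> bits) \<Rightarrow> ('a \<Rightarrow> nat set) \<Rightarrow> bool" where
  "local_witness_set N f M X I \<longleftrightarrow>
     random_input_and_set N M X I \<and> witness_set N f M X I \<and> local_set N M X I"

text \<open>A definition cannot range over probability spaces of all types. Taking \<open>M\<close> over one fixed type
  that can carry the joint law of \<open>(X, I)\<close> loses nothing: by \<open>local_witness_set_transfer\<close> below,
  a local witness set on a probability space of any type has the expected size of one over this type.
  The infimum is a minimum: the joint laws of \<open>(X, I)\<close> form a compact set, as independence from
  the fixed uniform law is a closed condition.\<close>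

definition local_witness_sizes :: "nat \<Rightarrow> (bits \<Rightarrow> bool) \<Rightarrow> real set" where
  "local_witness_sizes N f =
     {\<integral>\<omega>. real (card (I \<omega>)) \<partial>M | (M :: (bits \<times> nat set) measure) X I.
        local_witness_set N f M X I}"

definition local_witness_compl :: "nat \<Rightarrow> (bits \<Rightarrow> bool) \<Rightarrow> real" where
  "local_witness_compl N f = Inf (local_witness_sizes N f)"

lemma local_witness_set_transfer:
  fixes M :: "'a measure"
  assumes "local_witness_set N f M X I"
  shows "(\<integral>\<omega>. real (card (I \<omega>)) \<partial>M) \<in> local_witness_sizes N f"
proof -
  interpret prob_space M
    using assms by (simp add: local_witness_set_def random_input_and_set_def)
  define S where "S = bitcube N \<times> Pow {1..N}"
  define \<phi> where "\<phi> = (\<lambda>\<omega>. (X \<omega>, I \<omega>))"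
  define M' where "M' = distr M (count_space S) \<phi>"
  have X [measurable]: "X \<in> M \<rightarrow>\<^sub>M count_space (bitcube N)"
    and dX: "distr M (count_space (bitcube N)) X = pi_half N"
    and I [measurable]: "I \<in> M \<rightarrow>\<^sub>M count_space (Pow {1..N})"
    and wit: "AE \<omega> in M. determines N f (I \<omega>) (X \<omega>)"
    and loc: "local_set N M X I"
    using assms by (auto simp: local_witness_set_def random_input_and_set_def witness_set_def)
  have fin: "finite (bitcube N)"
    by (simp add: bitcube_def finite_PiE)
  have "\<phi> \<in> M \<rightarrow>\<^sub>M count_space (bitcube N) \<Otimes>\<^sub>M count_space (Pow {1..N})"
    unfolding \<phi>_def by measurable
  then have \<phi> [measurable]: "\<phi> \<in> M \<rightarrow>\<^sub>M count_space S"
    by (simp add: S_def pair_measure_count_space fin)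
  have spM': "space M' = S" by (simp add: M'_def)
  interpret M': prob_space M'
    unfolding M'_def by (rule prob_space_distr) (rule \<phi>)
  have \<phi>S: "\<phi> \<omega> \<in> S" if "\<omega> \<in> space M" for \<omega>
    using measurable_space[OF \<phi> that] by simp
  have fst_m: "fst \<in> count_space S \<rightarrow>\<^sub>M count_space (bitcube N)"
    by (auto simp: S_def)
  have snd_m: "snd \<in> count_space S \<rightarrow>\<^sub>M count_space (Pow {1..N})"
    by (auto simp: S_def)
  have "distr M' (count_space (bitcube N)) fst = pi_half N"
    unfolding M'_def dX[symmetric] by (subst distr_distr[OF fst_m \<phi>]) (simp add: \<phi>_def comp_def)
  then have 1: "random_input_and_set N M' fst snd"
    unfolding random_input_and_set_def using M'.prob_space_axioms fst_m snd_m
    by (simp add: M'_def)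
  have 2: "witness_set N f M' fst snd"
    unfolding witness_set_def M'_def
    by (subst AE_distr_iff[OF \<phi>]) (use wit in \<open>auto simp: \<phi>_def\<close>)
  have pull: "\<phi> -` a \<inter> space M \<in> sigma_sets (space M) G"
    if "a \<in> sigma_sets S G'" "{\<phi> -` A \<inter> space M | A. A \<in> G'} \<subseteq> G" for a G G'
  proof -
    have "\<phi> \<in> space M \<rightarrow> S" using \<phi>S by auto
    from sigma_sets_vimage_commute[OF this, of G'] that(1)
    have "\<phi> -` a \<inter> space M \<in> sigma_sets (space M) {\<phi> -` A \<inter> space M | A. A \<in> G'}" by blast
    then show ?thesis using sigma_sets_mono'[OF that(2)] by blast
  qed
  have 3: "local_set N M' fst snd"
    unfolding local_set_def
  proof (intro allI impI)
    fix J assume J: "J \<subseteq> {1..N}"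
    let ?A = "insert {\<omega> \<in> space M. I \<omega> = J} {{\<omega> \<in> space M. X \<omega> i} | i. i \<in> J}"
    let ?B = "{{\<omega> \<in> space M. X \<omega> i} | i. i \<in> {1..N} - J}"
    let ?A' = "insert {\<omega> \<in> space M'. snd \<omega> = J} {{\<omega> \<in> space M'. fst \<omega> i} | i. i \<in> J}"
    let ?B' = "{{\<omega> \<in> space M'. fst \<omega> i} | i. i \<in> {1..N} - J}"
    have ind: "indep_set (sigma_sets (space M) ?A) (sigma_sets (space M) ?B)"
      using loc J unfolding local_set_def by blast
    have pI: "\<phi> -` {\<omega> \<in> space M'. snd \<omega> = J} \<inter> space M = {\<omega> \<in> space M. I \<omega> = J}"
      using \<phi>S by (auto simp: spM' \<phi>_def)
    have pX: "\<phi> -` {\<omega> \<in> space M'. fst \<omega> i} \<inter> space M = {\<omega> \<in> space M. X \<omega> i}" for i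
      using \<phi>S by (auto simp: spM' \<phi>_def)
    have subA: "{\<phi> -` A \<inter> space M | A. A \<in> ?A'} \<subseteq> ?A"
      using pI pX by blast
    have subB: "{\<phi> -` A \<inter> space M | A. A \<in> ?B'} \<subseteq> ?B"
      using pX by blast
    show "M'.indep_set (sigma_sets (space M') ?A') (sigma_sets (space M') ?B')"
      unfolding M'.indep_set_def M'.indep_sets2_eq[unfolded M'.indep_set_def]
    proof (intro conjI ballI)
      show evA: "sigma_sets (space M') ?A' \<subseteq> M'.events"
        by (intro sets.sigma_sets_subset) (auto simp: M'_def)
      show evB: "sigma_sets (space M') ?B' \<subseteq> M'.events"
        by (intro sets.sigma_sets_subset) (auto simp: M'_def)
      fix a b
      assume a: "a \<in> sigma_sets (space M') ?A'" and b: "b \<in> sigma_sets (space M') ?B'"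
      have m: "M'.prob c = prob (\<phi> -` c \<inter> space M)" if "c \<in> M'.events" for c
        using that unfolding M'_def by (intro measure_distr[OF \<phi>]) simp
      have a1: "\<phi> -` a \<inter> space M \<in> sigma_sets (space M) ?A"
        by (rule pull[OF a[unfolded spM'] subA[unfolded spM']])
      have b1: "\<phi> -` b \<inter> space M \<in> sigma_sets (space M) ?B"
        by (rule pull[OF b[unfolded spM'] subB[unfolded spM']])
      have ea: "a \<in> M'.events" and eb: "b \<in> M'.events" using a b evA evB by auto
      have "M'.prob (a \<inter> b) = prob ((\<phi> -` a \<inter> space M) \<inter> (\<phi> -` b \<inter> space M))"
        using m[OF sets.Int[OF ea eb]] by (simp add: Int_ac vimage_Int)
      also have "\<dots> = prob (\<phi> -` a \<inter> space M) * prob (\<phi> -` b \<inter> space M)"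
        using indep_setD[OF ind a1 b1] .
      finally show "M'.prob (a \<inter> b) = M'.prob a * M'.prob b"
        using m[OF ea] m[OF eb] by simp
    qed
  qed
  have "(\<integral>\<omega>. real (card (snd \<omega>)) \<partial>M') = (\<integral>\<omega>. real (card (I \<omega>)) \<partial>M)"
    unfolding M'_def by (subst integral_distr[OF \<phi>]) (auto simp: \<phi>_def)
  then show ?thesis
    using 1 2 3 unfolding local_witness_sizes_def local_witness_set_def mem_Collect_eq
    by (intro exI[of _ M'] exI[of _ fst] exI[of _ snd]) simp
qed

end

theory Submission
  imports Defs
begin

text \<open>
  The three separations have different causes.

  \<^item> Block sensitivity is at least 1 at every input of a nonconstant function, while the conjunction
    of \<open>n\<close> bits has only \<open>n + 1\<close> inputs with any sensitive bit. So its average sensitivity is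
    exponentially small (\<open>sens_all_ones_le\<close>).

  \<^item> For the threshold function that asks for more than \<open>k\<close> ones on \<open>8 * k\<close> bits, every
    witness has more than \<open>k\<close> bits (\<open>witness_at_more_ones_than\<close>). A typical input has about
    \<open>4 * k\<close> ones. To change the value, a block must remove more than half of them, so two sensitive
    blocks are hardly ever disjoint and the average block sensitivity is bounded (\<open>block_sens_more_ones_than_le\<close>).

  \<^item> The tribes function asks whether one of \<open>M\<close> disjoint tribes of \<open>m\<close> bits is filled with ones.
    There are so many tribes that with high probability one of them is, which gives a witness of
    \<open>m\<close> bits. But a local set must find it without looking at the rest. To make this precise, a local witness
    set is replaced by its conditional law \<open>q J x\<close> given the input, which depends only on the bits in
    \<open>J\<close> (\<open>local_witness_set_kernel\<close>). Suppose that exactly one tribe is full. Let \<open>x\<close> and \<open>x'\<close> be two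
    such inputs, with the tribes \<open>t\<close> and \<open>s\<close> full, that coincide once both are filled, say to \<open>z\<close>.
    The event that the set at \<open>x\<close> misses \<open>s\<close> and the event that the set at \<open>x'\<close> misses \<open>t\<close> have the
    same probabilities at \<open>z\<close>, where they exclude each other, because a witness at \<open>x\<close> contains \<open>t\<close> and
    one at \<open>x'\<close> contains \<open>s\<close> (\<open>sum_missing_swap\<close>). Hence on average the set meets half of all tribes
    (\<open>kernel_size_ge\<close>). With \<open>M = n * 2 ^ m\<close>, exactly one tribe is full with at least \<open>n\<close> times the
    probability that none is, and only in the latter case are the shortest witnesses longer than \<open>m\<close>.
    A suitable \<open>m\<close> makes that case dominate the witness complexity.
\<close>

section \<open>The uniform measure on the cube\<close>

lemma finite_bitcube [simp]: "finite (bitcube N)"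
  by (simp add: bitcube_def finite_PiE)

lemma card_bitcube [simp]: "card (bitcube N) = 2 ^ N"
  by (simp add: bitcube_def card_PiE)

lemma bitcube_nonempty: "bitcube N \<noteq> {}"
  by (simp add: bitcube_def PiE_eq_empty_iff)

lemma expectation_pi_half:
  fixes F :: "bits \<Rightarrow> real"
  shows "(\<integral>x. F x \<partial>pi_half N) = (\<Sum>x\<in>bitcube N. F x) / 2 ^ N"
  unfolding pi_half_def by (subst integral_uniform_count_measure) simp_all

lemma flip_bits_bitcube [simp]:
  "x \<in> bitcube N \<Longrightarrow> B \<subseteq> {1..N} \<Longrightarrow> flip_bits B x \<in> bitcube N"
  by (auto simp: bitcube_def flip_bits_def PiE_def extensional_def)

lemma flip_bits_flip_bits [simp]: "flip_bits B (flip_bits B x) = x"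
  by (auto simp: flip_bits_def)

lemma override_on_bitcube [simp]:
  "x \<in> bitcube N \<Longrightarrow> y \<in> bitcube N \<Longrightarrow> override_on x y J \<in> bitcube N"
  by (auto simp: bitcube_def override_on_def PiE_def extensional_def)

lemma bitcube_eqI:
  "x \<in> bitcube N \<Longrightarrow> y \<in> bitcube N \<Longrightarrow> (\<And>i. i \<in> {1..N} \<Longrightarrow> x i = y i) \<Longrightarrow> x = y"
  unfolding bitcube_def by (rule PiE_ext)

definition bits_of :: "nat \<Rightarrow> nat set \<Rightarrow> bits" where
  "bits_of N S = restrict (\<lambda>i. i \<in> S) {1..N}"

lemma bits_of_bitcube [simp]: "bits_of N S \<in> bitcube N"
  by (simp add: bits_of_def bitcube_def)

lemma bits_of_apply [simp]: "i \<in> {1..N} \<Longrightarrow> bits_of N S i \<longleftrightarrow> i \<in> S"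
  by (simp add: bits_of_def)

text \<open>Exchanging the bits of \<open>x\<close> and \<open>y\<close> in \<open>J\<close> is an involution on pairs \<open>(x, y)\<close> that turns
  \<open>A \<times> B\<close> into \<open>(A \<inter> B) \<times> bitcube N\<close>. This is the independence of disjoint sets of coordinates, in the
  form of a count.\<close>

lemma card_Int_independent:
  assumes A: "A \<subseteq> bitcube N" "\<And>x y. x \<in> A \<Longrightarrow> y \<in> bitcube N \<Longrightarrow> \<forall>i\<in>J. y i = x i \<Longrightarrow> y \<in> A"
    and B: "B \<subseteq> bitcube N"
      "\<And>x y. x \<in> B \<Longrightarrow> y \<in> bitcube N \<Longrightarrow> \<forall>i\<in>{1..N} - J. y i = x i \<Longrightarrow> y \<in> B"
  shows "card (A \<inter> B) * 2 ^ N = card A * card B"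
proof -
  let ?h = "\<lambda>(x, y). (override_on y x J, override_on x y J)"
  have inv: "?h (?h z) = z" for z :: "bits \<times> bits"
    by (auto simp: override_on_def fun_eq_iff split: prod.splits)
  have "bij_betw ?h (A \<times> B) ((A \<inter> B) \<times> bitcube N)"
  proof (rule bij_betw_byWitness[where f' = ?h])
    show "\<forall>z\<in>A \<times> B. ?h (?h z) = z" "\<forall>z\<in>(A \<inter> B) \<times> bitcube N. ?h (?h z) = z"
      using inv by blast+
    show "?h ` (A \<times> B) \<subseteq> (A \<inter> B) \<times> bitcube N"
    proof safe
      fix x y assume "x \<in> A" "y \<in> B"
      then have c: "x \<in> bitcube N" "y \<in> bitcube N" using A(1) B(1) by auto
      show "override_on y x J \<in> A"
        by (rule A(2)[OF \<open>x \<in> A\<close>]) (use c in auto)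
      show "override_on y x J \<in> B"
        by (rule B(2)[OF \<open>y \<in> B\<close>]) (use c in auto)
      show "override_on x y J \<in> bitcube N" using c by simp
    qed
    show "?h ` ((A \<inter> B) \<times> bitcube N) \<subseteq> A \<times> B"
    proof safe
      fix x y assume "x \<in> A" "x \<in> B" and y: "y \<in> bitcube N"
      then have c: "x \<in> bitcube N" using A(1) by auto
      show "override_on y x J \<in> A"
        by (rule A(2)[OF \<open>x \<in> A\<close>]) (use c y in auto)
      show "override_on x y J \<in> B"
        by (rule B(2)[OF \<open>x \<in> B\<close>]) (use c y in auto)
    qed
  qed
  from bij_betw_same_card[OF this] show ?thesis
    by (simp add: card_cartesian_product)
qed

section \<open>Witnesses and sensitive blocks\<close>

lemma determines_iff:
  assumes "x \<in> bitcube N"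
  shows "determines N f W x \<longleftrightarrow> (\<forall>y\<in>bitcube N. (\<forall>i\<in>W. y i = x i) \<longrightarrow> f y = f x)"
proof -
  have "restrict y W = restrict x W \<longleftrightarrow> (\<forall>i\<in>W. y i = x i)" for y
    by (auto simp: restrict_def fun_eq_iff)
  then have eq: "{y \<in> bitcube N. restrict y W = restrict x W} = {y \<in> bitcube N. \<forall>i\<in>W. y i = x i}"
    by simp
  show ?thesis
    unfolding determines_def constant_on_def eq using assms by blast
qed

lemma finite_witness_cards: "finite {card W | W. W \<subseteq> {1..N} \<and> determines N f W x}"
  by (rule finite_subset[of _ "card ` Pow {1..N}"]) auto

lemma witness_at_le:
  "W \<subseteq> {1..N} \<Longrightarrow> determines N f W x \<Longrightarrow> witness_at N f x \<le> card W"
  unfolding witness_at_def by (rule Min_le[OF finite_witness_cards]) blast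

lemma determines_all: "x \<in> bitcube N \<Longrightarrow> determines N f {1..N} x"
  by (subst determines_iff) (auto dest: bitcube_eqI)

lemma witness_at_attained:
  assumes "x \<in> bitcube N"
  obtains W where "W \<subseteq> {1..N}" "determines N f W x" "card W = witness_at N f x"
proof -
  have "witness_at N f x \<in> {card W | W. W \<subseteq> {1..N} \<and> determines N f W x}"
    unfolding witness_at_def using determines_all[OF assms, of f]
    by (intro Min_in[OF finite_witness_cards]) blast
  then show ?thesis using that by (elim CollectE exE conjE) simp
qed

lemma finite_block_cards:
  "finite {card \<B> | \<B>. \<B> \<subseteq> Pow {1..N} \<and> disjoint \<B> \<and> (\<forall>B\<in>\<B>. f (flip_bits B x) \<noteq> f x)}"
proof (rule finite_subset)
  show "{card \<B> | \<B>. \<B> \<subseteq> Pow {1..N} \<and> disjoint \<B> \<and> (\<forall>B\<in>\<B>. f (flip_bits B x) \<noteq> f x)}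
    \<subseteq> card ` Pow (Pow {1..N})" by auto
qed simp

lemma block_sens_at_le:
  assumes "\<And>\<B>. \<B> \<subseteq> Pow {1..N} \<Longrightarrow> disjoint \<B> \<Longrightarrow> \<forall>B\<in>\<B>. f (flip_bits B x) \<noteq> f x \<Longrightarrow> card \<B> \<le> b"
  shows "block_sens_at N f x \<le> b"
  unfolding block_sens_at_def
proof (rule Max.boundedI[OF finite_block_cards])
  show "{card \<B> | \<B>. \<B> \<subseteq> Pow {1..N} \<and> disjoint \<B> \<and> (\<forall>B\<in>\<B>. f (flip_bits B x) \<noteq> f x)} \<noteq> {}"
    by (simp add: exI[of _ "{}"])
qed (use assms in blast)

text \<open>Where \<open>f\<close> takes both values, the set of coordinates in which \<open>x\<close> and \<open>y\<close> differ is a sensitive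
  block at \<open>x\<close>.\<close>

lemma block_sens_at_ge_1:
  assumes x: "x \<in> bitcube N" and y: "y \<in> bitcube N" and "f y \<noteq> f x"
  shows "1 \<le> block_sens_at N f x"
  unfolding block_sens_at_def
proof (rule Max_ge[OF finite_block_cards])
  let ?B = "{i \<in> {1..N}. y i \<noteq> x i}"
  have "flip_bits ?B x = y"
  proof (rule bitcube_eqI[of _ N])
    show "flip_bits ?B x \<in> bitcube N" using x by (intro flip_bits_bitcube) auto
  qed (use y in \<open>auto simp: flip_bits_def\<close>)
  then show "1 \<in> {card \<B> | \<B>. \<B> \<subseteq> Pow {1..N} \<and> disjoint \<B> \<and> (\<forall>B\<in>\<B>. f (flip_bits B x) \<noteq> f x)}"
    using \<open>f y \<noteq> f x\<close> by (intro CollectI exI[of _ "{?B}"]) (auto simp: disjoint_def)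
qed

lemma block_sens_ge_1:
  assumes "u \<in> bitcube N" "v \<in> bitcube N" "f u \<noteq> f v"
  shows "1 \<le> block_sens N f"
proof -
  have "1 \<le> block_sens_at N f x" if "x \<in> bitcube N" for x
    using block_sens_at_ge_1[OF that, of u f] block_sens_at_ge_1[OF that, of v f] assms by metis
  then have "(\<Sum>x\<in>bitcube N. 1) \<le> (\<Sum>x\<in>bitcube N. real (block_sens_at N f x))"
    by (intro sum_mono) fastforce
  then show ?thesis by (simp add: block_sens_def expectation_pi_half)
qed

section \<open>Block sensitivity against sensitivity: conjunction\<close>

definition all_ones :: "nat \<Rightarrow> bits \<Rightarrow> bool" where
  "all_ones N x \<longleftrightarrow> (\<forall>i\<in>{1..N}. x i)"

lemma sens_all_ones_pos:
  assumes "N > 0" shows "sens N (all_ones N) > 0"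
proof -
  let ?x = "bits_of N {1..N}"
  have "1 \<in> {i \<in> {1..N}. all_ones N (flip_bits {i} ?x) \<noteq> all_ones N ?x}"
    using assms by (auto simp: all_ones_def flip_bits_def)
  then have "sens_at N (all_ones N) ?x > 0"
    unfolding sens_at_def card_gt_0_iff by (intro conjI) (blast, simp)
  then have "0 < (\<Sum>x\<in>bitcube N. real (sens_at N (all_ones N) x))"
    by (intro sum_pos2[of _ ?x]) auto
  then show ?thesis by (simp add: sens_def expectation_pi_half)
qed

text \<open>For each coordinate only two inputs are sensitive, the all-ones input and its neighbour.\<close>

lemma sens_all_ones_le: "sens N (all_ones N) \<le> 2 * N / 2 ^ N"
proof -
  let ?f = "all_ones N" and ?x = "bits_of N {1..N}"
  have "(\<Sum>x\<in>bitcube N. sens_at N ?f x)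
      = (\<Sum>x\<in>bitcube N. \<Sum>i\<in>{1..N}. if ?f (flip_bits {i} x) \<noteq> ?f x then 1 else 0)"
    unfolding sens_at_def by (intro sum.cong refl) (simp add: sum.If_cases Int_def)
  also have "\<dots> = (\<Sum>i\<in>{1..N}. card {x \<in> bitcube N. ?f (flip_bits {i} x) \<noteq> ?f x})"
    by (subst sum.swap) (simp add: sum.If_cases Int_def)
  also have "\<dots> \<le> (\<Sum>i\<in>{1..N}. 2)"
  proof (rule sum_mono)
    fix i assume i: "i \<in> {1..N}"
    have one: "x = ?x" if "x \<in> bitcube N" "?f x" for x
      by (rule bitcube_eqI[OF _ bits_of_bitcube]) (use that in \<open>auto simp: all_ones_def\<close>)
    have "x \<in> {?x, flip_bits {i} ?x}" if "x \<in> bitcube N" "?f (flip_bits {i} x) \<noteq> ?f x" for x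
    proof (cases "?f x")
      case False
      then have "flip_bits {i} x = ?x" using that i by (intro one) auto
      then show ?thesis using flip_bits_flip_bits[of "{i}" x] by auto
    qed (use one that in auto)
    then have "{x \<in> bitcube N. ?f (flip_bits {i} x) \<noteq> ?f x} \<subseteq> {?x, flip_bits {i} ?x}" by blast
    then have "card {x \<in> bitcube N. ?f (flip_bits {i} x) \<noteq> ?f x} \<le> card {?x, flip_bits {i} ?x}"
      by (intro card_mono) auto
    also have "\<dots> \<le> 2" by (simp add: card_insert_if)
    finally show "card {x \<in> bitcube N. ?f (flip_bits {i} x) \<noteq> ?f x} \<le> 2" .
  qed
  finally have "(\<Sum>x\<in>bitcube N. sens_at N ?f x) \<le> 2 * N" by simp
  then have "(\<Sum>x\<in>bitcube N. real (sens_at N ?f x)) \<le> 2 * N"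
    by (metis of_nat_le_iff of_nat_sum of_nat_mult of_nat_numeral)
  then show ?thesis by (simp add: sens_def expectation_pi_half divide_right_mono)
qed

lemma power2_le_two_power: "4 \<le> n \<Longrightarrow> n ^ 2 \<le> (2::nat) ^ n"
proof (induction n rule: nat_induct_at_least)
  case (Suc n)
  then have "4 * n \<le> n * n" by simp
  moreover have "(Suc n) ^ 2 = n * n + 2 * n + 1" by (simp add: power2_eq_square)
  ultimately have "(Suc n) ^ 2 \<le> 2 * n ^ 2" using Suc.hyps unfolding power2_eq_square by linarith
  with Suc show ?case by simp
qed simp

lemma block_sens_over_sens_all_ones:
  "LIM n sequentially. block_sens n (all_ones n) / sens n (all_ones n) :> at_top"
proof (rule filterlim_at_top_mono)
  show "LIM n sequentially. (1 / 2 * real n) :> at_top"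
    by (intro filterlim_tendsto_pos_mult_at_top[OF tendsto_const] filterlim_real_sequentially) simp
  show "\<forall>\<^sub>F n in sequentially. 1 / 2 * real n \<le> block_sens n (all_ones n) / sens n (all_ones n)"
  proof (rule eventually_sequentiallyI[of 4])
    fix n :: nat assume n: "4 \<le> n"
    let ?b = "block_sens n (all_ones n)" and ?s = "sens n (all_ones n)"
    have b: "1 \<le> ?b"
      by (rule block_sens_ge_1[of "bits_of n {1..n}" _ "bits_of n {}"])
        (use n in \<open>auto simp: all_ones_def\<close>)
    have s: "0 < ?s" using sens_all_ones_pos n by simp
    have "real (n ^ 2) \<le> real (2 ^ n)"
      using power2_le_two_power[OF n] by (simp only: of_nat_le_iff)
    then have "real n * (2 * n / 2 ^ n) \<le> 2"
      by (simp add: field_simps power2_eq_square)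
    moreover have "real n * ?s \<le> real n * (2 * n / 2 ^ n)"
      using sens_all_ones_le[of n] by (intro mult_left_mono) auto
    ultimately have "1 / 2 * real n * ?s \<le> ?b" using b by linarith
    then show "1 / 2 * real n \<le> ?b / ?s"
      using s by (simp only: pos_le_divide_eq)
  qed
qed

section \<open>Witness complexity against block sensitivity: a threshold\<close>

definition ones :: "nat \<Rightarrow> bits \<Rightarrow> nat set" where
  "ones N x = {i \<in> {1..N}. x i}"

lemma finite_ones [simp]: "finite (ones N x)"
  by (simp add: ones_def)

definition more_ones_than :: "nat \<Rightarrow> nat \<Rightarrow> bits \<Rightarrow> bool" where
  "more_ones_than k N x \<longleftrightarrow> k < card (ones N x)"

text \<open>After at most \<open>k\<close> bits are revealed, the others can still be all zeros, which leaves at most \<open>k\<close>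
  ones, or all ones, which makes more than \<open>k\<close>. So every input, of either value, needs a witness of
  more than \<open>k\<close> bits.\<close>

lemma witness_at_more_ones_than:
  assumes "2 * k < N" and x: "x \<in> bitcube N"
  shows "k < witness_at N (more_ones_than k N) x"
proof -
  let ?f = "more_ones_than k N"
  obtain W where W: "W \<subseteq> {1..N}" "determines N ?f W x" "card W = witness_at N ?f x"
    using witness_at_attained[OF x] .
  have "k < card W"
  proof (rule ccontr)
    assume k: "\<not> k < card W"
    let ?y = "override_on (bits_of N {}) x W" and ?z = "override_on (bits_of N {1..N}) x W"
    have "ones N ?y \<subseteq> W" by (auto simp: ones_def override_on_def split: if_splits)
    then have "card (ones N ?y) \<le> card W"
      using W(1) by (intro card_mono) (auto dest: finite_subset)
    moreover have "{1..N} - W \<subseteq> ones N ?z" by (auto simp: ones_def)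
    then have "card ({1..N} - W) \<le> card (ones N ?z)" by (intro card_mono) auto
    moreover have "card ({1..N} - W) = N - card W"
      using W(1) by (subst card_Diff_subset) (auto dest: finite_subset)
    ultimately have "?f ?z \<noteq> ?f ?y" using k assms(1) by (simp add: more_ones_than_def)
    moreover have "?f ?y = ?f x" "?f ?z = ?f x"
      by (rule W(2)[unfolded determines_iff[OF x], rule_format]; simp add: x)+
    ultimately show False by simp
  qed
  then show ?thesis using W(3) by simp
qed

text \<open>Each block uses up \<open>d\<close> elements of \<open>S\<close>, and disjoint blocks use different ones.\<close>

lemma card_disjoint_blocks_le:
  assumes \<B>: "disjoint \<B>" "\<And>B. B \<in> \<B> \<Longrightarrow> d \<le> card (B \<inter> S)" and S: "finite S" "card S < (c + 1) * d"
  shows "card \<B> \<le> c"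
proof (cases "finite \<B>")
  case True
  have "card \<B> * d = (\<Sum>B\<in>\<B>. d)" by simp
  also have "\<dots> \<le> (\<Sum>B\<in>\<B>. card (B \<inter> S))" by (rule sum_mono) (rule \<B>(2))
  also have "\<dots> = card (\<Union>B\<in>\<B>. B \<inter> S)"
    by (rule card_UN_disjoint[symmetric]) (use True S \<B>(1) in \<open>auto simp: disjoint_def\<close>)
  also have "\<dots> \<le> card S" by (rule card_mono) (use S in auto)
  also have "\<dots> < (c + 1) * d" by (rule S(2))
  finally show ?thesis by (simp only: mult_less_cancel2) simp
qed simp

lemma card_ones_flip: 
  assumes "B \<subseteq> {1..N}"
  shows "card (ones N x) \<le> card (ones N (flip_bits B x)) + card (B \<inter> ones N x)"
proof -
  have "ones N x \<subseteq> ones N (flip_bits B x) \<union> (B \<inter> ones N x)"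
    by (auto simp: ones_def flip_bits_def)
  then have "card (ones N x) \<le> card (ones N (flip_bits B x) \<union> (B \<inter> ones N x))"
    by (intro card_mono) auto
  also have "\<dots> \<le> card (ones N (flip_bits B x)) + card (B \<inter> ones N x)" by (rule card_Un_le)
  finally show ?thesis .
qed

text \<open>A sensitive block must remove all the surplus ones at once, so it contains at least
  \<open>card (ones N x) - k\<close> of them. If there are many more ones than \<open>k\<close>, few disjoint blocks fit.\<close>

lemma block_sens_at_more_ones_than:
  assumes "k < card (ones N x)" "card (ones N x) < (c + 1) * (card (ones N x) - k)"
  shows "block_sens_at N (more_ones_than k N) x \<le> c"
proof (rule block_sens_at_le)
  fix \<B> assume \<B>: "\<B> \<subseteq> Pow {1..N}" "disjoint \<B>"
    "\<forall>B\<in>\<B>. more_ones_than k N (flip_bits B x) \<noteq> more_ones_than k N x"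
  show "card \<B> \<le> c"
  proof (rule card_disjoint_blocks_le[OF \<B>(2)])
    fix B assume B: "B \<in> \<B>"
    then have "card (ones N (flip_bits B x)) \<le> k"
      using \<B>(3) assms(1) by (auto simp: more_ones_than_def)
    with card_ones_flip[of B N x] B \<B>(1) show "card (ones N x) - k \<le> card (B \<inter> ones N x)"
      by auto
  qed (use assms in auto)
qed

lemma block_sens_at_le_N: "block_sens_at N f x \<le> N"
proof (rule block_sens_at_le)
  fix \<B> assume \<B>: "\<B> \<subseteq> Pow {1..N}" "disjoint \<B>" "\<forall>B\<in>\<B>. f (flip_bits B x) \<noteq> f x"
  show "card \<B> \<le> N"
  proof (rule card_disjoint_blocks_le[OF \<B>(2), where d = 1 and S = "{1..N}"])
    fix B assume B: "B \<in> \<B>"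
    have "B \<noteq> {}" using \<B>(3) B by (auto simp: flip_bits_def)
    moreover have "B \<subseteq> {1..N}" using \<B>(1) B by auto
    ultimately show "1 \<le> card (B \<inter> {1..N})"
      by (simp add: Int_absorb2 Suc_le_eq card_gt_0_iff finite_subset[of B "{1..N}"])
  qed auto
qed

text \<open>The exponential moment that controls the rare inputs with few ones.\<close>

lemma sum_half_power_ones: "(\<Sum>x\<in>bitcube N. (1 / 2 :: real) ^ card (ones N x)) = (3 / 2) ^ N"
proof -
  have "(3 / 2 :: real) ^ N = (\<Prod>i\<in>{1..N}. \<Sum>b\<in>UNIV. if b then 1 / 2 else 1)"
    by (simp add: UNIV_bool)
  also have "\<dots> = (\<Sum>x\<in>bitcube N. \<Prod>i\<in>{1..N}. if x i then 1 / 2 else 1)"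
    unfolding bitcube_def by (rule prod_sum_PiE) auto
  also have "\<dots> = (\<Sum>x\<in>bitcube N. (1 / 2) ^ card (ones N x))"
    by (intro sum.cong refl) (simp add: prod.If_cases ones_def Int_def)
  finally show ?thesis ..
qed

text \<open>Inputs with at least \<open>2 * k\<close> ones have block sensitivity at most 2. The others have at most \<open>N\<close>,
  and by Markov's inequality for \<open>(1 / 2) ^ card (ones N x)\<close> they are a fraction of at most
  \<open>4 ^ k * (3 / 4) ^ N\<close> of the cube.\<close>

lemma block_sens_more_ones_than_le:
  assumes "0 < k"
  shows "block_sens N (more_ones_than k N) \<le> 2 + N * 4 ^ k * (3 / 4) ^ N"
proof -
  let ?b = "\<lambda>x. block_sens_at N (more_ones_than k N) x"
  have pt: "real (?b x) \<le> 2 + N * 4 ^ k * (1 / 2) ^ card (ones N x)" for x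
  proof (cases "2 * k \<le> card (ones N x)")
    case True
    then have "?b x \<le> 2" using assms by (intro block_sens_at_more_ones_than) auto
    then have "real (?b x) \<le> 2" by simp
    then show ?thesis by (smt (verit) mult_nonneg_nonneg of_nat_0_le_iff zero_le_power divide_nonneg_pos)
  next
    case False
    then have "(1 / 2 :: real) ^ (2 * k) \<le> (1 / 2) ^ card (ones N x)"
      by (intro power_decreasing) auto
    then have "N * 4 ^ k * (1 / 2 :: real) ^ (2 * k) \<le> N * 4 ^ k * (1 / 2) ^ card (ones N x)"
      by (intro mult_left_mono) auto
    moreover have "(4::real) ^ k * (1 / 2) ^ (2 * k) = 1"
      by (simp add: power_mult power_divide)
    ultimately have "real N \<le> N * 4 ^ k * (1 / 2) ^ card (ones N x)"
      by (simp add: mult.assoc)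
    moreover have "real (?b x) \<le> N" using block_sens_at_le_N by simp
    ultimately show ?thesis by linarith
  qed
  have "(\<Sum>x\<in>bitcube N. real (?b x)) \<le> (\<Sum>x\<in>bitcube N. 2 + N * 4 ^ k * (1 / 2) ^ card (ones N x))"
    by (rule sum_mono) (rule pt)
  also have "\<dots> = 2 ^ N * (2 + N * 4 ^ k * (3 / 4) ^ N)"
  proof -
    have "(3 / 2 :: real) ^ N = 2 ^ N * (3 / 4) ^ N" by (simp flip: power_mult_distrib)
    then show ?thesis
      by (simp add: sum.distrib sum_half_power_ones distrib_left flip: sum_distrib_left)
  qed
  finally show ?thesis by (simp add: block_sens_def expectation_pi_half pos_divide_le_eq mult.commute)
qed

lemma witness_over_block_sens_more_ones_than:
  "LIM k sequentially. witness_compl (8 * k) (more_ones_than k (8 * k))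
     / block_sens (8 * k) (more_ones_than k (8 * k)) :> at_top"
proof (rule filterlim_at_top_mono)
  show "LIM k sequentially. (1 / 10 * real k) :> at_top"
    by (intro filterlim_tendsto_pos_mult_at_top[OF tendsto_const] filterlim_real_sequentially) simp
  show "\<forall>\<^sub>F k in sequentially. 1 / 10 * real k \<le> witness_compl (8 * k) (more_ones_than k (8 * k))
     / block_sens (8 * k) (more_ones_than k (8 * k))"
  proof (rule eventually_sequentiallyI[of 1])
    fix k :: nat assume k: "1 \<le> k"
    define N where "N = 8 * k"
    let ?f = "more_ones_than k N"
    let ?b = "block_sens N ?f" and ?w = "witness_compl N ?f"
    have "(\<Sum>x\<in>bitcube N. real k) \<le> (\<Sum>x\<in>bitcube N. real (witness_at N ?f x))"
      using k by (intro sum_mono) (simp add: N_def witness_at_more_ones_than less_imp_le)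
    then have w: "real k \<le> ?w"
      by (simp add: witness_compl_def expectation_pi_half pos_le_divide_eq mult.commute)
    have "k < N" using k by (simp add: N_def)
    moreover have "ones N (bits_of N {}) = {}" "ones N (bits_of N {1..N}) = {1..N}"
      by (auto simp: ones_def)
    ultimately have b1: "1 \<le> ?b"
      by (intro block_sens_ge_1[of "bits_of N {1..N}" _ "bits_of N {}"])
        (simp_all add: more_ones_than_def)
    \<comment> \<open>The number of bits is \<open>8 * k\<close> because the base \<open>4 * (3 / 4) ^ 8\<close> is then below 1/2.\<close>
    have "(4::real) ^ k * (3 / 4) ^ N = (4 * (3 / 4) ^ 8) ^ k"
      by (simp add: N_def power_mult power_mult_distrib)
    also have "\<dots> \<le> (1 / 2) ^ k" by (intro power_mono) (simp_all add: power_divide)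
    finally have "real N * (4 ^ k * (3 / 4) ^ N) \<le> real N * (1 / 2) ^ k"
      by (intro mult_left_mono) auto
    also have "\<dots> \<le> 8"
    proof -
      have "real k \<le> 2 ^ k" using of_nat_less_two_power[of k, where ?'a = real] by simp
      then show ?thesis by (simp add: N_def power_divide pos_divide_le_eq)
    qed
    finally have "?b \<le> 10" using block_sens_more_ones_than_le[of k N] k by (simp add: mult.assoc)
    then have "real k * ?b \<le> ?w * 10" using w b1 by (intro mult_mono) auto
    then have "1 / 10 * real k \<le> ?w / ?b"
      using b1 by (simp add: pos_le_divide_eq)
    then show "1 / 10 * real k \<le> witness_compl (8 * k) (more_ones_than k (8 * k))
     / block_sens (8 * k) (more_ones_than k (8 * k))" by (simp add: N_def)
  qed
qed

section \<open>Local witness sets as kernels\<close>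

text \<open>With \<open>R\<close> being agreement on a set of coordinates, this says that the sigma-algebra that these
  coordinates generate contains only sets that depend on them alone.\<close>

lemma sigma_sets_closed_under:
  assumes "a \<in> sigma_sets S G"
    and G: "\<And>g x y. g \<in> G \<Longrightarrow> x \<in> g \<Longrightarrow> y \<in> S \<Longrightarrow> R x y \<Longrightarrow> y \<in> g" "\<And>g. g \<in> G \<Longrightarrow> g \<subseteq> S"
    and R: "\<And>x y. R x y \<Longrightarrow> R y x"
  shows "a \<subseteq> S \<and> (\<forall>x\<in>a. \<forall>y\<in>S. R x y \<longrightarrow> y \<in> a)"
  using assms(1)
proof induction
  case (Basic a)
  then show ?case using G by blast
next
  case (Compl a)
  then show ?case using R by blast
next
  case (Union a)
  then show ?case by blast
qed simp

lemma space_pi_half [simp]: "space (pi_half N) = bitcube N"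
  by (simp add: pi_half_def space_uniform_count_measure)

lemma sets_pi_half [simp]: "sets (pi_half N) = Pow (bitcube N)"
  by (simp add: pi_half_def sets_uniform_count_measure)

lemma measure_pi_half: "A \<subseteq> bitcube N \<Longrightarrow> measure (pi_half N) A = card A / 2 ^ N"
  by (simp add: pi_half_def measure_uniform_count_measure)

lemma prob_space_pi_half: "prob_space (pi_half N)"
  unfolding pi_half_def by (rule prob_space_uniform_count_measure) (simp_all add: bitcube_nonempty)

text \<open>Revealing every bit is a local witness set. Hence the infimum that defines the local witness
  complexity is taken over a nonempty set, and a bound for all local witness sets bounds it.\<close>

lemma local_witness_set_everything:
  "local_witness_set N f (pi_half N) (\<lambda>x. x) (\<lambda>_. {1..N})"
proof -
  interpret prob_space "pi_half N" by (rule prob_space_pi_half)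
  have "distr (pi_half N) (count_space (bitcube N)) (\<lambda>x. x) = pi_half N"
    by (rule distr_id2) simp
  then have "random_input_and_set N (pi_half N) (\<lambda>x. x) (\<lambda>_. {1..N})"
    unfolding random_input_and_set_def using prob_space_pi_half by (simp add: measurable_def)
  moreover have "witness_set N f (pi_half N) (\<lambda>x. x) (\<lambda>_. {1..N})"
    unfolding witness_set_def by (rule AE_I2, rule determines_all) simp
  moreover have "local_set N (pi_half N) (\<lambda>x. x) (\<lambda>_. {1..N})"
    unfolding local_set_def
  proof (intro allI impI)
    fix J assume J: "J \<subseteq> {1..N}"
    let ?A = "sigma_sets (bitcube N) (insert {x \<in> bitcube N. {1..N} = J} {{x \<in> bitcube N. x i} | i. i \<in> J})"
    let ?B = "sigma_sets (bitcube N) {{x \<in> bitcube N. x i} | i. i \<in> {1..N} - J}"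
    have A: "a \<subseteq> bitcube N \<and> (\<forall>x\<in>a. \<forall>y\<in>bitcube N. (\<forall>i\<in>J. y i = x i) \<longrightarrow> y \<in> a)" if "a \<in> ?A" for a
      by (rule sigma_sets_closed_under[OF that]) auto
    have B: "b \<subseteq> bitcube N \<and> (\<forall>x\<in>b. \<forall>y\<in>bitcube N. (\<forall>i\<in>{1..N} - J. y i = x i) \<longrightarrow> y \<in> b)"
      if "b \<in> ?B" for b
      by (rule sigma_sets_closed_under[OF that]) auto
    have "indep_set ?A ?B"
    proof (rule indep_setI)
      show "?A \<subseteq> events"
      proof
        fix a assume "a \<in> ?A"
        from A[OF this] show "a \<in> events" by simp
      qed
      show "?B \<subseteq> events"
      proof
        fix b assume "b \<in> ?B"
        from B[OF this] show "b \<in> events" by simp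
      qed
      fix a b assume a: "a \<in> ?A" and b: "b \<in> ?B"
      have "card (a \<inter> b) * 2 ^ N = card a * card b"
      proof (rule card_Int_independent[where J = J])
        show "y \<in> a" if "x \<in> a" "y \<in> bitcube N" "\<forall>i\<in>J. y i = x i" for x y
          using A[OF a] that by simp
        show "y \<in> b" if "x \<in> b" "y \<in> bitcube N" "\<forall>i\<in>{1..N} - J. y i = x i" for x y
          using B[OF b] that by simp
      qed (simp_all add: A[OF a] B[OF b])
      then have "real (card (a \<inter> b)) * 2 ^ N = real (card a) * real (card b)"
        by (metis of_nat_mult of_nat_numeral of_nat_power)
      moreover have "a \<subseteq> bitcube N" "b \<subseteq> bitcube N" "a \<inter> b \<subseteq> bitcube N"
        using A[OF a] B[OF b] by (simp_all add: le_infI1)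
      ultimately show "prob (a \<inter> b) = prob a * prob b"
        by (simp add: measure_pi_half field_simps)
    qed
    then show "indep_set (sigma_sets (space (pi_half N))
           (insert {\<omega> \<in> space (pi_half N). {1..N} = J} {{\<omega> \<in> space (pi_half N). \<omega> i} | i. i \<in> J}))
        (sigma_sets (space (pi_half N)) {{\<omega> \<in> space (pi_half N). \<omega> i} | i. i \<in> {1..N} - J})"
      by simp
  qed
  ultimately show ?thesis by (simp add: local_witness_set_def)
qed

lemma local_witness_compl_ge:
  assumes "\<And>(M :: (bits \<times> nat set) measure) X I.
    local_witness_set N f M X I \<Longrightarrow> c \<le> (\<integral>\<omega>. real (card (I \<omega>)) \<partial>M)"
  shows "c \<le> local_witness_compl N f"
  unfolding local_witness_compl_def
proof (rule cInf_greatest)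
  show "local_witness_sizes N f \<noteq> {}"
    using local_witness_set_transfer[OF local_witness_set_everything] by blast
qed (use assms in \<open>auto simp: local_witness_sizes_def\<close>)

lemma card_agreeing_le:
  assumes "x \<in> bitcube N" "y \<in> bitcube N"
  shows "card {z \<in> bitcube N. \<forall>i\<in>K. z i = x i} \<le> card {z \<in> bitcube N. \<forall>i\<in>K. z i = y i}"
proof (rule card_inj_on_le)
  show "inj_on (\<lambda>z. override_on z y K) {z \<in> bitcube N. \<forall>i\<in>K. z i = x i}"
  proof (rule inj_onI, clarify)
    fix z z' assume z: "\<forall>i\<in>K. z i = x i" "\<forall>i\<in>K. z' i = x i"
      and eq: "override_on z y K = override_on z' y K"
    show "z = z'"
    proof
      fix i show "z i = z' i" using z fun_cong[OF eq, of i] by (cases "i \<in> K") auto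
    qed
  qed
qed (use assms in auto)

text \<open>The event \<open>X = x\<close> is the intersection of \<open>X = x\<close> on \<open>J\<close> and \<open>X = x\<close> off \<open>J\<close>. By locality the latter
  is independent of \<open>I = J\<close> together with the former, and as \<open>X\<close> is uniform its probability is the
  same for all \<open>x\<close>. What remains involves \<open>x\<close> on \<open>J\<close> only.\<close>

lemma local_set_joint_prob:
  assumes rand: "random_input_and_set N M X I" and loc: "local_set N M X I"
    and J: "J \<subseteq> {1..N}" and x: "x \<in> bitcube N" and y: "y \<in> bitcube N" and xy: "\<forall>i\<in>J. y i = x i"
  shows "measure M {\<omega> \<in> space M. I \<omega> = J \<and> X \<omega> = y} = measure M {\<omega> \<in> space M. I \<omega> = J \<and> X \<omega> = x}"
proof -
  interpret prob_space M using rand by (simp add: random_input_and_set_def)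
  have X [measurable]: "X \<in> M \<rightarrow>\<^sub>M count_space (bitcube N)"
    and dX: "distr M (count_space (bitcube N)) X = pi_half N"
    using rand by (auto simp: random_input_and_set_def)
  have Xc: "X \<omega> \<in> bitcube N" if "\<omega> \<in> space M" for \<omega>
    using measurable_space[OF X that] by simp
  let ?A = "sigma_sets (space M) (insert {\<omega> \<in> space M. I \<omega> = J} {{\<omega> \<in> space M. X \<omega> i} | i. i \<in> J})"
  let ?B = "sigma_sets (space M) {{\<omega> \<in> space M. X \<omega> i} | i. i \<in> {1..N} - J}"
  define E where "E = {\<omega> \<in> space M. I \<omega> = J \<and> (\<forall>i\<in>J. X \<omega> i = x i)}"
  define F where "F = (\<lambda>u. {\<omega> \<in> space M. \<forall>i\<in>{1..N} - J. X \<omega> i = u i})"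
  have ind: "indep_set ?A ?B" using loc J by (simp add: local_set_def)
  interpret A: sigma_algebra "space M" ?A by (rule sigma_algebra_sigma_sets) auto
  interpret B: sigma_algebra "space M" ?B by (rule sigma_algebra_sigma_sets) auto
  have fin: "finite J" using J finite_subset by blast
  have "{\<omega> \<in> space M. X \<omega> i = x i} \<in> ?A" if "i \<in> J" for i
  proof -
    have "{\<omega> \<in> space M. X \<omega> i} \<in> ?A" using that by (intro sigma_sets.Basic) blast
    then show ?thesis using A.sets_Collect_neg by (cases "x i") simp_all
  qed
  then have "{\<omega> \<in> space M. \<forall>i\<in>J. X \<omega> i = x i} \<in> ?A"
    using fin by (intro A.sets_Collect_finite_All) auto
  moreover have "{\<omega> \<in> space M. I \<omega> = J} \<in> ?A" by (intro sigma_sets.Basic) simp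
  ultimately have E: "E \<in> ?A" unfolding E_def by (intro A.sets_Collect_conj)
  have F: "F u \<in> ?B" for u
  proof -
    have "{\<omega> \<in> space M. X \<omega> i = u i} \<in> ?B" if "i \<in> {1..N} - J" for i
    proof -
      have "{\<omega> \<in> space M. X \<omega> i} \<in> ?B" using that by (intro sigma_sets.Basic) blast
      then show ?thesis using B.sets_Collect_neg by (cases "u i") simp_all
    qed
    then show ?thesis unfolding F_def by (intro B.sets_Collect_finite_All) auto
  qed
  have split: "{\<omega> \<in> space M. I \<omega> = J \<and> X \<omega> = u} = E \<inter> F u"
    if u: "u \<in> bitcube N" "\<forall>i\<in>J. u i = x i" for u
  proof -
    have "X \<omega> = u \<longleftrightarrow> (\<forall>i\<in>J. X \<omega> i = x i) \<and> (\<forall>i\<in>{1..N} - J. X \<omega> i = u i)"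
      if "\<omega> \<in> space M" for \<omega>
    proof (intro iffI conjI)
      assume "(\<forall>i\<in>J. X \<omega> i = x i) \<and> (\<forall>i\<in>{1..N} - J. X \<omega> i = u i)"
      then show "X \<omega> = u"
        using u(2) by (intro bitcube_eqI[OF Xc[OF that] u(1)]) (metis DiffI)
    qed (use u(2) in auto)
    then show ?thesis by (auto simp: E_def F_def)
  qed
  have prob_F: "prob (F u) = card {z \<in> bitcube N. \<forall>i\<in>{1..N} - J. z i = u i} / 2 ^ N" for u
  proof -
    let ?C = "{z \<in> bitcube N. \<forall>i\<in>{1..N} - J. z i = u i}"
    have "card ?C / 2 ^ N = measure (distr M (count_space (bitcube N)) X) ?C"
      unfolding dX by (simp add: measure_pi_half)
    also have "\<dots> = prob (X -` ?C \<inter> space M)"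
      by (rule measure_distr[OF X]) simp
    also have "X -` ?C \<inter> space M = F u" using Xc by (auto simp: F_def)
    finally show ?thesis ..
  qed
  have "card {z \<in> bitcube N. \<forall>i\<in>{1..N} - J. z i = y i} = card {z \<in> bitcube N. \<forall>i\<in>{1..N} - J. z i = x i}"
    using card_agreeing_le[OF x y] card_agreeing_le[OF y x] by (rule antisym[rotated])
  then have "prob (F y) = prob (F x)" by (simp add: prob_F)
  then have "prob (E \<inter> F y) = prob (E \<inter> F x)"
    using indep_setD[OF ind E F] by simp
  then show ?thesis using split x y xy by simp
qed

text \<open>Think of \<open>q J x\<close> as the conditional probability of \<open>I = J\<close> given \<open>X = x\<close>. Locality becomes the
  condition that \<open>q J x\<close> depends only on the bits of \<open>x\<close> in \<open>J\<close>: such a \<open>q\<close> is an exact fractional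
  partition of the cube into subcubes on which \<open>f\<close> is constant.\<close>

definition local_certificate_kernel ::
    "nat \<Rightarrow> (bits \<Rightarrow> bool) \<Rightarrow> (nat set \<Rightarrow> bits \<Rightarrow> real) \<Rightarrow> bool" where
  "local_certificate_kernel N f q \<longleftrightarrow>
     (\<forall>J x. 0 \<le> q J x) \<and>
     (\<forall>x\<in>bitcube N. (\<Sum>J\<in>Pow {1..N}. q J x) = 1) \<and>
     (\<forall>J\<in>Pow {1..N}. \<forall>x\<in>bitcube N. \<forall>y\<in>bitcube N. (\<forall>i\<in>J. y i = x i) \<longrightarrow> q J y = q J x) \<and>
     (\<forall>J\<in>Pow {1..N}. \<forall>x\<in>bitcube N. q J x \<noteq> 0 \<longrightarrow> determines N f J x)"

text \<open>All further arguments about local witness sets take place on the finite cube.\<close>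

lemma local_witness_set_kernel:
  assumes "local_witness_set N f M X I"
  obtains q :: "nat set \<Rightarrow> bits \<Rightarrow> real" where "local_certificate_kernel N f q"
    "(\<integral>\<omega>. real (card (I \<omega>)) \<partial>M) = (\<Sum>x\<in>bitcube N. \<Sum>J\<in>Pow {1..N}. real (card J) * q J x) / 2 ^ N"
proof -
  have rand: "random_input_and_set N M X I" and wit: "AE \<omega> in M. determines N f (I \<omega>) (X \<omega>)"
    and loc: "local_set N M X I"
    using assms by (auto simp: local_witness_set_def witness_set_def)
  interpret prob_space M using rand by (simp add: random_input_and_set_def)
  have X [measurable]: "X \<in> M \<rightarrow>\<^sub>M count_space (bitcube N)"
    and dX: "distr M (count_space (bitcube N)) X = pi_half N"
    and I [measurable]: "I \<in> M \<rightarrow>\<^sub>M count_space (Pow {1..N})"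
    using rand by (auto simp: random_input_and_set_def)
  have Xc: "X \<omega> \<in> bitcube N" if "\<omega> \<in> space M" for \<omega>
    using measurable_space[OF X that] by simp
  have Ic: "I \<omega> \<in> Pow {1..N}" if "\<omega> \<in> space M" for \<omega>
    using measurable_space[OF I that] by simp
  define S where "S = (\<lambda>J x. {\<omega> \<in> space M. I \<omega> = J \<and> X \<omega> = x})"
  have S: "S J x \<in> events" if "x \<in> bitcube N" "J \<in> Pow {1..N}" for J x
  proof -
    have "S J x = (I -` {J} \<inter> space M) \<inter> (X -` {x} \<inter> space M)" by (auto simp: S_def)
    moreover have "I -` {J} \<inter> space M \<in> events" "X -` {x} \<inter> space M \<in> events"
      using that by (auto intro!: measurable_sets[OF I] measurable_sets[OF X])
    ultimately show ?thesis by (metis sets.Int)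
  qed
  define q where "q = (\<lambda>J x. 2 ^ N * prob (S J x))"
  have sum1: "(\<Sum>J\<in>Pow {1..N}. q J x) = 1" if x: "x \<in> bitcube N" for x
  proof -
    have "(\<Sum>J\<in>Pow {1..N}. prob (S J x)) = prob (\<Union>J\<in>Pow {1..N}. S J x)"
      by (rule finite_measure_finite_Union[symmetric])
        (use S[OF x] in \<open>auto simp: S_def disjoint_family_on_def\<close>)
    also have "(\<Union>J\<in>Pow {1..N}. S J x) = X -` {x} \<inter> space M" using Ic by (auto simp: S_def)
    also have "prob \<dots> = measure (distr M (count_space (bitcube N)) X) {x}"
      by (rule measure_distr[OF X, symmetric]) (use x in simp)
    also have "\<dots> = 1 / 2 ^ N" using x by (simp add: dX measure_pi_half)
    finally show ?thesis by (simp add: q_def flip: sum_distrib_left)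
  qed
  have local: "q J y = q J x"
    if "J \<in> Pow {1..N}" "x \<in> bitcube N" "y \<in> bitcube N" "\<forall>i\<in>J. y i = x i" for J x y
    using local_set_joint_prob[OF rand loc _ that(2,3,4)] that(1) by (simp add: q_def S_def)
  have det: "determines N f J x" if "J \<in> Pow {1..N}" "x \<in> bitcube N" "q J x \<noteq> 0" for J x
  proof (rule ccontr)
    assume "\<not> determines N f J x"
    then have "AE \<omega> in M. determines N f (I \<omega>) (X \<omega>) \<longrightarrow> \<omega> \<notin> S J x"
      by (intro AE_I2) (auto simp: S_def)
    with wit have "AE \<omega> in M. \<omega> \<notin> S J x" by (rule AE_mp)
    then have "prob (S J x) = 0"
      using prob_eq_0[OF S[OF that(2,1)]] by simp
    then show False using that(3) by (simp add: q_def)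
  qed
  have int: "integrable M (\<lambda>\<omega>. real (card J) * indicator (S J x) \<omega>)"
    if "x \<in> bitcube N" "J \<in> Pow {1..N}" for J x
    using S[OF that] by (intro integrable_mult_right integrable_real_indicator) (simp_all add: less_top[symmetric])
  have "(\<integral>\<omega>. real (card (I \<omega>)) \<partial>M)
      = (\<integral>\<omega>. (\<Sum>x\<in>bitcube N. \<Sum>J\<in>Pow {1..N}. real (card J) * indicator (S J x) \<omega>) \<partial>M)"
  proof (rule Bochner_Integration.integral_cong[OF refl])
    fix \<omega> assume \<omega>: "\<omega> \<in> space M"
    have "(\<Sum>x\<in>bitcube N. \<Sum>J\<in>Pow {1..N}. real (card J) * indicator (S J x) \<omega>)
        = (\<Sum>x\<in>bitcube N. \<Sum>J\<in>Pow {1..N}. if J = I \<omega> then (if x = X \<omega> then real (card J) else 0) else 0)"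
      using \<omega> by (intro sum.cong refl) (auto simp: S_def indicator_def)
    also have "\<dots> = real (card (I \<omega>))"
      using Xc[OF \<omega>] Ic[OF \<omega>] by (simp add: sum.delta')
    finally show "real (card (I \<omega>)) = (\<Sum>x\<in>bitcube N. \<Sum>J\<in>Pow {1..N}. real (card J) * indicator (S J x) \<omega>)" ..
  qed
  also have "\<dots> = (\<Sum>x\<in>bitcube N. \<integral>\<omega>. (\<Sum>J\<in>Pow {1..N}. real (card J) * indicator (S J x) \<omega>) \<partial>M)"
    by (intro Bochner_Integration.integral_sum Bochner_Integration.integrable_sum int)
  also have "\<dots> = (\<Sum>x\<in>bitcube N. \<Sum>J\<in>Pow {1..N}. \<integral>\<omega>. real (card J) * indicator (S J x) \<omega> \<partial>M)"
    by (intro sum.cong refl Bochner_Integration.integral_sum int)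
  also have "\<dots> = (\<Sum>x\<in>bitcube N. \<Sum>J\<in>Pow {1..N}. real (card J) * prob (S J x))"
    by (intro sum.cong refl) (simp add: S Int_absorb2 sets.sets_into_space)
  also have "\<dots> = (\<Sum>x\<in>bitcube N. \<Sum>J\<in>Pow {1..N}. real (card J) * q J x) / 2 ^ N"
    by (simp add: q_def sum_divide_distrib)
  finally have "(\<integral>\<omega>. real (card (I \<omega>)) \<partial>M)
    = (\<Sum>x\<in>bitcube N. \<Sum>J\<in>Pow {1..N}. real (card J) * q J x) / 2 ^ N" .
  moreover have "local_certificate_kernel N f q"
    unfolding local_certificate_kernel_def
  proof (intro conjI ballI allI impI)
    show "0 \<le> q J x" for J x by (simp add: q_def)
  qed (fact sum1 local det)+
  ultimately show ?thesis using that by blast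
qed

section \<open>Local witness complexity of tribes\<close>

definition tribe :: "nat \<Rightarrow> nat \<Rightarrow> nat set" where
  "tribe m t = {t * m + 1..t * m + m}"

definition all_on :: "nat \<Rightarrow> nat \<Rightarrow> bits \<Rightarrow> bool" where
  "all_on m t x \<longleftrightarrow> (\<forall>i\<in>tribe m t. x i)"

definition tribes :: "nat \<Rightarrow> nat \<Rightarrow> bits \<Rightarrow> bool" where
  "tribes m M x \<longleftrightarrow> (\<exists>t<M. all_on m t x)"

lemma card_tribe [simp]: "card (tribe m t) = m" and finite_tribe [simp]: "finite (tribe m t)"
  by (simp_all add: tribe_def)

lemma tribe_subset: 
  assumes "t < M" shows "tribe m t \<subseteq> {1..M * m}"
proof -
  have "Suc t * m \<le> M * m" using assms by (intro mult_le_mono1) simp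
  then show ?thesis by (auto simp: tribe_def)
qed

lemma tribe_disjoint: 
  assumes "s \<noteq> t" shows "tribe m s \<inter> tribe m t = {}"
proof -
  have "tribe m a \<inter> tribe m b = {}" if "a < b" for a b
  proof -
    have "Suc a * m \<le> b * m" using that by (intro mult_le_mono1) simp
    then show ?thesis by (auto simp: tribe_def)
  qed
  then show ?thesis using assms by (cases s t rule: linorder_cases) blast+
qed

lemma tribe_eqI: "i \<in> tribe m s \<Longrightarrow> i \<in> tribe m t \<Longrightarrow> s = t"
  using tribe_disjoint by blast

definition only_on :: "nat \<Rightarrow> nat \<Rightarrow> nat \<Rightarrow> bits set" where
  "only_on m M t = {x \<in> bitcube (M * m). \<forall>s<M. all_on m s x \<longleftrightarrow> s = t}"

text \<open>The translation that carries the tribe \<open>t\<close> to the tribe \<open>s\<close>.\<close>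

definition tribe_shift :: "nat \<Rightarrow> nat \<Rightarrow> nat \<Rightarrow> nat \<Rightarrow> nat" where
  "tribe_shift m t s i = i - t * m + s * m"

lemma shift_tribe: "i \<in> tribe m t \<Longrightarrow> tribe_shift m t s i \<in> tribe m s"
  by (auto simp: tribe_def tribe_shift_def)

lemma shift_shift: "i \<in> tribe m t \<Longrightarrow> tribe_shift m s t (tribe_shift m t s i) = i"
  by (auto simp: tribe_def tribe_shift_def)

lemma shift_self: "i \<in> tribe m t \<Longrightarrow> tribe_shift m t t i = i"
  by (auto simp: tribe_def tribe_shift_def)

definition swap_tribes :: "nat \<Rightarrow> nat \<Rightarrow> nat \<Rightarrow> bits \<Rightarrow> bits" where
  "swap_tribes m s t x = (\<lambda>i. if i \<in> tribe m t then x (tribe_shift m t s i)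
     else if i \<in> tribe m s then x (tribe_shift m s t i) else x i)"

lemma swap_tribes_swap_tribes [simp]: "swap_tribes m s t (swap_tribes m s t x) = x"
proof
  fix i show "swap_tribes m s t (swap_tribes m s t x) i = x i"
    using shift_tribe[of i m t s] shift_tribe[of i m s t] shift_shift[of i m t s]
      shift_shift[of i m s t] shift_self[of i m t] tribe_eqI[of _ m s t]
    by (cases "s = t") (auto simp: swap_tribes_def)
qed

lemma all_on_swap_tribes:
  "all_on m r (swap_tribes m s t x) \<longleftrightarrow> all_on m (if r = t then s else if r = s then t else r) x"
proof -
  have imp: "all_on m r (swap_tribes m s t x)" if "all_on m (if r = t then s else if r = s then t else r) x"
    for r x
    unfolding all_on_def
  proof
    fix i assume i: "i \<in> tribe m r"
    then have "i \<in> tribe m u \<longleftrightarrow> u = r" for u using tribe_eqI by blast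
    then show "swap_tribes m s t x i"
      using that i shift_tribe[OF i] by (auto simp: swap_tribes_def all_on_def split: if_splits)
  qed
  show ?thesis
  proof
    assume "all_on m r (swap_tribes m s t x)"
    then have "all_on m (if (if r = t then s else if r = s then t else r) = t then s
      else if (if r = t then s else if r = s then t else r) = s then t
      else (if r = t then s else if r = s then t else r)) (swap_tribes m s t x)"
      by (auto split: if_splits)
    from imp[OF this] show "all_on m (if r = t then s else if r = s then t else r) x" by simp
  qed (rule imp)
qed

lemma swap_tribes_only_on:
  assumes st: "s < M" "t < M" and x: "x \<in> only_on m M t"
  shows "swap_tribes m s t x \<in> only_on m M s"
proof -
  have "swap_tribes m s t x i = undefined" if "i \<notin> {1..M * m}" for i
  proof -
    have "i \<notin> tribe m s" "i \<notin> tribe m t" using that tribe_subset st by blast+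
    moreover have "x i = undefined" using x that PiE_arb unfolding only_on_def bitcube_def by blast
    ultimately show ?thesis by (simp add: swap_tribes_def)
  qed
  then have "swap_tribes m s t x \<in> bitcube (M * m)" unfolding bitcube_def by (intro PiE_I) auto
  then show ?thesis
    using x st by (auto simp: only_on_def all_on_swap_tribes)
qed

lemma swap_tribes_commute: "swap_tribes m s t x = swap_tribes m t s x"
  using tribe_eqI[of _ m s t] by (auto simp: swap_tribes_def fun_eq_iff)

lemma bij_betw_swap_tribes:
  assumes "s < M" "t < M"
  shows "bij_betw (swap_tribes m s t) (only_on m M t) (only_on m M s)"
proof (rule bij_betw_byWitness[where f' = "swap_tribes m s t"])
  show "swap_tribes m s t ` only_on m M t \<subseteq> only_on m M s"
    using swap_tribes_only_on[OF assms] by blast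
  show "swap_tribes m s t ` only_on m M s \<subseteq> only_on m M t"
    using swap_tribes_only_on[OF assms(2,1)] by (auto simp: swap_tribes_commute[of m s t])
qed simp_all

text \<open>If only the tribe \<open>t\<close> is on, a single zero in it makes the value false, so a witness must contain
  the whole tribe.\<close>

lemma determines_tribe_subset:
  assumes t: "t < M" and x: "x \<in> only_on m M t"
    and det: "determines (M * m) (tribes m M) J x"
  shows "tribe m t \<subseteq> J"
proof
  fix i assume i: "i \<in> tribe m t"
  have xc: "x \<in> bitcube (M * m)" using x by (simp add: only_on_def)
  show "i \<in> J"
  proof (rule ccontr)
    assume "i \<notin> J"
    let ?y = "override_on x (bits_of (M * m) {}) {i}"
    have "i \<in> {1..M * m}" using i tribe_subset[OF t] by blast
    then have yi: "\<not> ?y i" by simp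
    have yj: "?y j = x j" if "j \<noteq> i" for j using that by simp
    have "tribes m M ?y = tribes m M x"
      using det xc yj \<open>i \<notin> J\<close> unfolding determines_iff[OF xc] by (metis bits_of_bitcube override_on_bitcube)
    moreover have "tribes m M x" using x t by (auto simp: tribes_def only_on_def)
    ultimately obtain s where s: "s < M" "all_on m s ?y" by (auto simp: tribes_def)
    have "i \<notin> tribe m s" using s(2) yi by (auto simp: all_on_def)
    then have "s \<noteq> t" "all_on m s x" using i s(2) yj unfolding all_on_def by metis+
    then show False using x s(1) by (auto simp: only_on_def)
  qed
qed

context
  fixes m M :: nat and q :: "nat set \<Rightarrow> bits \<Rightarrow> real"
  assumes m: "0 < m"
    and kernel: "local_certificate_kernel (M * m) (tribes m M) q"
begin

private lemmas kernel_conjs = kernel[unfolded local_certificate_kernel_def]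

private lemmas q_nonneg = kernel_conjs[THEN conjunct1, rule_format]
  and q_sum = kernel_conjs[THEN conjunct2, THEN conjunct1, rule_format]
  and q_local = kernel_conjs[THEN conjunct2, THEN conjunct2, THEN conjunct1, rule_format]
  and q_determines = kernel_conjs[THEN conjunct2, THEN conjunct2, THEN conjunct2, rule_format]

definition missing :: "nat \<Rightarrow> nat set set" where
  "missing s = {J \<in> Pow {1..M * m}. J \<inter> tribe m s = {}}"

text \<open>A set \<open>J\<close> that misses the tribe \<open>s\<close> does not notice a change inside this tribe, so its weight at
  \<open>x\<close> is also its weight at \<open>z\<close>. Unless it contains the tribe \<open>t\<close>, it is not a witness at \<open>x\<close>
  and this weight is 0.\<close>

lemma sum_missing_le:
  assumes st: "s < M" "t < M" and x: "x \<in> only_on m M t"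
    and z: "z \<in> bitcube (M * m)" "\<And>i. i \<notin> tribe m s \<Longrightarrow> z i = x i"
  shows "(\<Sum>J\<in>missing s. q J x) \<le> (\<Sum>J\<in>{J \<in> missing s. tribe m t \<subseteq> J}. q J z)"
proof -
  have xc: "x \<in> bitcube (M * m)" using x by (simp add: only_on_def)
  have "(\<Sum>J\<in>missing s. q J x) = (\<Sum>J\<in>{J \<in> missing s. tribe m t \<subseteq> J}. q J x)"
  proof (rule sum.mono_neutral_right)
    show "\<forall>J\<in>missing s - {J \<in> missing s. tribe m t \<subseteq> J}. q J x = 0"
    proof
      fix J assume J: "J \<in> missing s - {J \<in> missing s. tribe m t \<subseteq> J}"
      then have "J \<in> Pow {1..M * m}" "\<not> tribe m t \<subseteq> J" by (auto simp: missing_def)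
      then show "q J x = 0"
        using determines_tribe_subset[OF st(2) x] q_determines[OF _ xc] by blast
    qed
  qed (auto simp: missing_def)
  also have "\<dots> = (\<Sum>J\<in>{J \<in> missing s. tribe m t \<subseteq> J}. q J z)"
  proof (rule sum.cong[OF refl])
    fix J assume "J \<in> {J \<in> missing s. tribe m t \<subseteq> J}"
    then have J: "J \<in> Pow {1..M * m}" "J \<inter> tribe m s = {}" by (auto simp: missing_def)
    show "q J x = q J z" by (rule q_local[OF J(1) z(1) xc]) (use J z(2) in auto)
  qed
  finally show ?thesis by simp
qed

text \<open>The heart of the lower bound. The inputs \<open>x\<close> and \<open>swap_tribes m s t x\<close> become the same input \<open>z\<close>
  when the tribe \<open>s\<close>, respectively \<open>t\<close>, is filled with ones. By the preceding lemma both sums are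
  weights of sets at \<open>z\<close>. The first counts sets that miss \<open>s\<close> and contain \<open>t\<close>, the second sets that
  miss \<open>t\<close> and contain \<open>s\<close>, so together they are at most the total weight at \<open>z\<close>.\<close>

lemma sum_missing_swap:
  assumes st: "s < M" "t < M" and x: "x \<in> only_on m M t"
  shows "(\<Sum>J\<in>missing s. q J x) + (\<Sum>J\<in>missing t. q J (swap_tribes m s t x)) \<le> 1"
proof -
  let ?x' = "swap_tribes m s t x"
  let ?z = "override_on x (bits_of (M * m) {1..M * m}) (tribe m s)"
  have xc: "x \<in> bitcube (M * m)" using x by (simp add: only_on_def)
  then have z: "?z \<in> bitcube (M * m)" by simp
  have x': "?x' \<in> only_on m M s" using swap_tribes_only_on[OF st x] .
  have zx': "?z i = ?x' i" if "i \<notin> tribe m t" for i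
  proof (cases "i \<in> tribe m s")
    case True
    then have "?x' i" using x' st by (auto simp: only_on_def all_on_def)
    moreover have "i \<in> {1..M * m}" using True tribe_subset[OF st(1)] by blast
    ultimately show ?thesis using True by simp
  qed (use that in \<open>simp add: swap_tribes_def\<close>)
  let ?A = "{J \<in> missing s. tribe m t \<subseteq> J}" and ?B = "{J \<in> missing t. tribe m s \<subseteq> J}"
  have "tribe m s \<noteq> {}" using m by (auto simp: tribe_def)
  then have "?A \<inter> ?B = {}" by (auto simp: missing_def)
  moreover have fin: "finite ?A" "finite ?B" by (simp_all add: missing_def)
  ultimately have "(\<Sum>J\<in>?A. q J ?z) + (\<Sum>J\<in>?B. q J ?z) = (\<Sum>J\<in>?A \<union> ?B. q J ?z)"
    by (simp add: sum.union_disjoint)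
  also have "\<dots> \<le> (\<Sum>J\<in>Pow {1..M * m}. q J ?z)"
    by (rule sum_mono2) (auto simp: missing_def q_nonneg)
  also have "\<dots> = 1" by (rule q_sum[OF z])
  finally show ?thesis
    using sum_missing_le[OF st x z] sum_missing_le[OF st(2,1) x' z zx'] by simp
qed

text \<open>Summing over all pairs of tribes, on the inputs with exactly one tribe on, a random set drawn from
  the kernel meets on average at least half of the tribes. It therefore has on average at least
  \<open>M / 2\<close> elements there.\<close>

lemma kernel_size_ge:
  "real M / 2 * (\<Sum>t<M. real (card (only_on m M t)))
    \<le> (\<Sum>x\<in>bitcube (M * m). \<Sum>J\<in>Pow {1..M * m}. real (card J) * q J x)"
proof -
  let ?P = "Pow {1..M * m}"
  define miss where "miss = (\<lambda>t s. \<Sum>x\<in>only_on m M t. \<Sum>J\<in>missing s. q J x)"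
  define e where "e = (\<lambda>t. real (card (only_on m M t)))"
  have fin: "finite (only_on m M t)" for t by (simp add: only_on_def)
  have pair: "miss t s + miss s t \<le> e t" if st: "s < M" "t < M" for s t
  proof -
    have "miss s t = (\<Sum>x\<in>only_on m M t. \<Sum>J\<in>missing t. q J (swap_tribes m s t x))"
      unfolding miss_def by (rule sum.reindex_bij_betw[OF bij_betw_swap_tribes[OF st], symmetric])
    then have "miss t s + miss s t = (\<Sum>x\<in>only_on m M t. (\<Sum>J\<in>missing s. q J x)
        + (\<Sum>J\<in>missing t. q J (swap_tribes m s t x)))"
      by (simp add: miss_def sum.distrib)
    also have "\<dots> \<le> (\<Sum>x\<in>only_on m M t. 1)"
      by (rule sum_mono) (rule sum_missing_swap[OF st])
    finally show ?thesis by (simp add: e_def)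
  qed
  have size: "(\<Sum>s<M. 1 - (\<Sum>J\<in>missing s. q J x)) \<le> (\<Sum>J\<in>?P. real (card J) * q J x)"
    if x: "x \<in> bitcube (M * m)" for x
  proof -
    have hit: "(\<Sum>s<M. if J \<inter> tribe m s = {} then 0 else 1) \<le> real (card J)" if "J \<in> ?P" for J
    proof -
      have fJ: "finite J" using that finite_subset by auto
      have "(\<Sum>s<M. if J \<inter> tribe m s = {} then 0 else 1) \<le> (\<Sum>s<M. card (J \<inter> tribe m s))"
        by (rule sum_mono) (auto simp: Suc_le_eq card_gt_0_iff fJ)
      also have "\<dots> = card (\<Union>s<M. J \<inter> tribe m s)"
        by (rule card_UN_disjoint[symmetric]) (use tribe_eqI fJ in blast)+
      also have "\<dots> \<le> card J" by (rule card_mono) (use fJ in auto)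
      finally show ?thesis by (simp flip: of_nat_le_iff[where ?'a = real] add: of_nat_sum if_distrib cong: if_cong)
    qed
    have "1 - (\<Sum>J\<in>missing s. q J x) = (\<Sum>J\<in>?P. (if J \<inter> tribe m s = {} then 0 else 1) * q J x)" for s
    proof -
      have "(\<Sum>J\<in>missing s. q J x) = (\<Sum>J\<in>?P. if J \<inter> tribe m s = {} then q J x else 0)"
        unfolding missing_def by (rule sum.inter_filter) simp
      then have "1 - (\<Sum>J\<in>missing s. q J x)
          = (\<Sum>J\<in>?P. q J x - (if J \<inter> tribe m s = {} then q J x else 0))"
        by (simp only: q_sum[OF x] sum_subtractf)
      also have "\<dots> = (\<Sum>J\<in>?P. (if J \<inter> tribe m s = {} then 0 else 1) * q J x)"
        by (intro sum.cong) auto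
      finally show ?thesis .
    qed
    then have "(\<Sum>s<M. 1 - (\<Sum>J\<in>missing s. q J x))
        = (\<Sum>s<M. \<Sum>J\<in>?P. (if J \<inter> tribe m s = {} then 0 else 1) * q J x)" by simp
    also have "\<dots> = (\<Sum>J\<in>?P. (\<Sum>s<M. if J \<inter> tribe m s = {} then 0 else 1) * q J x)"
      by (subst sum.swap) (simp add: sum_distrib_right)
    also have "\<dots> \<le> (\<Sum>J\<in>?P. real (card J) * q J x)"
      by (intro sum_mono mult_right_mono hit q_nonneg)
    finally show ?thesis .
  qed
  \<comment> \<open>Symmetrising in \<open>s\<close> and \<open>t\<close> makes the pairwise bound applicable.\<close>
  have "2 * (\<Sum>t<M. \<Sum>s<M. e t - miss t s)
      = (\<Sum>t<M. \<Sum>s<M. e t - miss t s) + (\<Sum>t<M. \<Sum>s<M. e s - miss s t)"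
    by (subst (3) sum.swap) simp
  also have "\<dots> = (\<Sum>t<M. \<Sum>s<M. e s + (e t - (miss t s + miss s t)))"
    by (simp add: algebra_simps flip: sum.distrib)
  also have "\<dots> \<ge> (\<Sum>t<M. \<Sum>s<M. e s)"
    by (intro sum_mono) (use pair in auto)
  finally have "real M * (\<Sum>t<M. e t) \<le> 2 * (\<Sum>t<M. \<Sum>s<M. e t - miss t s)" by simp
  also have "(\<Sum>t<M. \<Sum>s<M. e t - miss t s)
      = (\<Sum>t<M. \<Sum>x\<in>only_on m M t. \<Sum>s<M. 1 - (\<Sum>J\<in>missing s. q J x))"
  proof (rule sum.cong[OF refl])
    fix t
    have "(\<Sum>s<M. e t - miss t s) = (\<Sum>s<M. \<Sum>x\<in>only_on m M t. 1 - (\<Sum>J\<in>missing s. q J x))"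
      by (simp add: e_def miss_def sum_subtractf)
    also have "\<dots> = (\<Sum>x\<in>only_on m M t. \<Sum>s<M. 1 - (\<Sum>J\<in>missing s. q J x))"
      by (rule sum.swap)
    finally show "(\<Sum>s<M. e t - miss t s) = (\<Sum>x\<in>only_on m M t. \<Sum>s<M. 1 - (\<Sum>J\<in>missing s. q J x))" .
  qed
  also have "\<dots> \<le> (\<Sum>t<M. \<Sum>x\<in>only_on m M t. \<Sum>J\<in>?P. real (card J) * q J x)"
    by (intro sum_mono size) (simp add: only_on_def)
  also have "\<dots> = (\<Sum>x\<in>(\<Union>t<M. only_on m M t). \<Sum>J\<in>?P. real (card J) * q J x)"
    by (rule sum.UNION_disjoint[symmetric]) (use fin in \<open>auto simp: only_on_def\<close>)
  also have "\<dots> \<le> (\<Sum>x\<in>bitcube (M * m). \<Sum>J\<in>?P. real (card J) * q J x)"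
    by (rule sum_mono2) (auto simp: only_on_def q_nonneg intro!: sum_nonneg)
  finally show ?thesis by (simp add: e_def)
qed

end

lemma local_witness_compl_tribes_ge:
  assumes "0 < m"
  shows "real M / 2 * (\<Sum>t<M. real (card (only_on m M t))) / 2 ^ (M * m)
    \<le> local_witness_compl (M * m) (tribes m M)"
proof (rule local_witness_compl_ge)
  fix \<Omega> :: "(bits \<times> nat set) measure" and X I
  assume "local_witness_set (M * m) (tribes m M) \<Omega> X I"
  then obtain q where q: "local_certificate_kernel (M * m) (tribes m M) q"
    "(\<integral>\<omega>. real (card (I \<omega>)) \<partial>\<Omega>)
      = (\<Sum>x\<in>bitcube (M * m). \<Sum>J\<in>Pow {1..M * m}. real (card J) * q J x) / 2 ^ (M * m)"
    by (rule local_witness_set_kernel)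
  then show "real M / 2 * (\<Sum>t<M. real (card (only_on m M t))) / 2 ^ (M * m)
    \<le> (\<integral>\<omega>. real (card (I \<omega>)) \<partial>\<Omega>)"
    unfolding q(2) by (intro divide_right_mono kernel_size_ge[OF assms q(1)]) simp
qed

section \<open>Local witness complexity against witness complexity: many tribes\<close>

definition none_on :: "nat \<Rightarrow> nat \<Rightarrow> nat \<Rightarrow> bits set" where
  "none_on m M k = {x \<in> bitcube (M * m). \<forall>t<k. \<not> all_on m t x}"

text \<open>Filling the tribe \<open>t\<close> with ones turns an input without tribes on into one with exactly \<open>t\<close> on, and
  forgets only the bits inside the tribe.\<close>

lemma card_none_on_le:
  assumes t: "t < M"
  shows "card (none_on m M M) \<le> card (only_on m M t) * 2 ^ m"
proof -
  let ?h = "\<lambda>x. (override_on x (bits_of (M * m) {1..M * m}) (tribe m t), {i \<in> tribe m t. x i})"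
  have "card (none_on m M M) \<le> card (only_on m M t \<times> Pow (tribe m t))"
  proof (rule card_inj_on_le)
    show "inj_on ?h (none_on m M M)"
    proof (rule inj_onI, clarify)
      fix x y
      assume o: "override_on x (bits_of (M * m) {1..M * m}) (tribe m t)
          = override_on y (bits_of (M * m) {1..M * m}) (tribe m t)"
        and s: "{i \<in> tribe m t. x i} = {i \<in> tribe m t. y i}"
      show "x = y"
      proof
        fix i show "x i = y i"
          using fun_cong[OF o, of i] s by (cases "i \<in> tribe m t") auto
      qed
    qed
    show "?h ` none_on m M M \<subseteq> only_on m M t \<times> Pow (tribe m t)"
    proof (rule image_subsetI)
      fix x assume x: "x \<in> none_on m M M"
      let ?y = "override_on x (bits_of (M * m) {1..M * m}) (tribe m t)"
      have "all_on m t ?y" using tribe_subset[OF t, of m] by (auto simp: all_on_def)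
      moreover have "\<not> all_on m s ?y" if "s < M" "s \<noteq> t" for s
      proof -
        have "\<not> all_on m s x" using x that(1) by (simp add: none_on_def)
        then obtain i where "i \<in> tribe m s" "\<not> x i" by (auto simp: all_on_def)
        moreover from this have "i \<notin> tribe m t" using tribe_eqI that(2) by blast
        ultimately show ?thesis unfolding all_on_def by force
      qed
      ultimately have "?y \<in> only_on m M t"
        using x by (auto simp: only_on_def none_on_def)
      then show "?h x \<in> only_on m M t \<times> Pow (tribe m t)" by auto
    qed
    show "finite (only_on m M t \<times> Pow (tribe m t))" by (simp add: only_on_def)
  qed
  then show ?thesis by (simp add: card_cartesian_product card_Pow)
qed

lemma card_all_on_le:
  assumes t: "t < M"
  shows "card {x \<in> bitcube (M * m). all_on m t x} * 2 ^ m \<le> 2 ^ (M * m)"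
proof -
  let ?A = "{x \<in> bitcube (M * m). all_on m t x}"
  have "card (?A \<times> Pow (tribe m t)) \<le> card (bitcube (M * m))"
  proof (rule card_inj_on_le)
    show "inj_on (\<lambda>(x, S). flip_bits S x) (?A \<times> Pow (tribe m t))"
    proof (rule inj_onI, clarify)
      fix x S y T
      assume xy: "all_on m t x" "all_on m t y" "S \<subseteq> tribe m t" "T \<subseteq> tribe m t"
        and eq: "flip_bits S x = flip_bits T y"
      have "(i \<in> S \<longleftrightarrow> i \<in> T) \<and> x i = y i" for i
        using fun_cong[OF eq, of i] xy
        by (cases "i \<in> tribe m t") (auto simp: flip_bits_def all_on_def split: if_splits)
      then show "x = y \<and> S = T" by auto
    qed
    show "(\<lambda>(x, S). flip_bits S x) ` (?A \<times> Pow (tribe m t)) \<subseteq> bitcube (M * m)"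
      using tribe_subset[OF t, of m] by auto
  qed simp
  then show ?thesis by (simp add: card_cartesian_product card_Pow)
qed

text \<open>The tribes are independent, and each of them is on with probability at most \<open>1 / 2 ^ m\<close>.\<close>

lemma card_none_on_ge:
  assumes "k \<le> M"
  shows "(1 - 1 / 2 ^ m) ^ k * 2 ^ (M * m) \<le> real (card (none_on m M k))"
  using assms
proof (induction k)
  case 0
  then show ?case by (simp add: none_on_def)
next
  case (Suc k)
  let ?N = "M * m"
  let ?A = "{x \<in> bitcube ?N. all_on m k x}"
  have k: "k < M" using Suc.prems by simp
  have "none_on m M (Suc k) = none_on m M k \<inter> (bitcube ?N - ?A)"
    by (auto simp: none_on_def less_Suc_eq)
  moreover have "card (none_on m M k \<inter> (bitcube ?N - ?A)) * 2 ^ ?N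
      = card (none_on m M k) * card (bitcube ?N - ?A)"
  proof (rule card_Int_independent[where J = "\<Union>t<k. tribe m t"])
    fix x y assume x: "x \<in> none_on m M k" and y: "y \<in> bitcube ?N" "\<forall>i\<in>\<Union>t<k. tribe m t. y i = x i"
    have "all_on m t y \<longleftrightarrow> all_on m t x" if "t < k" for t
      using y(2) that by (auto simp: all_on_def)
    then show "y \<in> none_on m M k" using x y(1) by (auto simp: none_on_def)
  next
    fix x y assume x: "x \<in> bitcube ?N - ?A" and y: "y \<in> bitcube ?N"
      "\<forall>i\<in>{1..?N} - (\<Union>t<k. tribe m t). y i = x i"
    have "y i = x i" if "i \<in> tribe m k" for i
    proof -
      have "i \<in> {1..?N}" using that tribe_subset[OF k] by blast
      moreover have "i \<notin> (\<Union>t<k. tribe m t)" using that tribe_eqI by blast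
      ultimately show ?thesis using y(2) by blast
    qed
    then show "y \<in> bitcube ?N - ?A" using x y(1) by (auto simp: all_on_def)
  qed (auto simp: none_on_def)
  ultimately have eq: "real (card (none_on m M (Suc k))) * 2 ^ ?N
      = real (card (none_on m M k)) * real (card (bitcube ?N - ?A))"
    by (metis of_nat_mult of_nat_numeral of_nat_power)
  have "card (bitcube ?N - ?A) = 2 ^ ?N - card ?A" by (subst card_Diff_subset) auto
  moreover have "card ?A \<le> 2 ^ ?N" using card_mono[of "bitcube ?N" ?A] by auto
  ultimately have c: "real (card (bitcube ?N - ?A)) = 2 ^ ?N - real (card ?A)"
    by (simp add: of_nat_diff)
  have "real (card ?A * 2 ^ m) \<le> real (2 ^ ?N)"
    using card_all_on_le[OF k] by (simp only: of_nat_le_iff)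
  then have "(1 - 1 / 2 ^ m) * 2 ^ ?N \<le> real (card (bitcube ?N - ?A))"
    unfolding c by (simp add: field_simps)
  then have "((1 - 1 / 2 ^ m) ^ k * 2 ^ ?N) * ((1 - 1 / 2 ^ m) * 2 ^ ?N)
      \<le> real (card (none_on m M k)) * real (card (bitcube ?N - ?A))"
    using Suc.IH k by (intro mult_mono) (auto simp: field_simps)
  then have "((1 - 1 / 2 ^ m) ^ Suc k * 2 ^ ?N) * 2 ^ ?N \<le> real (card (none_on m M (Suc k))) * 2 ^ ?N"
    unfolding eq by (simp add: mult_ac)
  then show ?case by (simp only: mult_le_cancel_right_pos zero_less_power zero_less_numeral)
qed

text \<open>A tribe that is on is a witness. If there is none, one zero from every tribe is a witness.\<close>

lemma witness_at_tribes_le: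
  assumes x: "x \<in> bitcube (M * m)"
  shows "witness_at (M * m) (tribes m M) x \<le> (if x \<in> none_on m M M then M else m)"
proof (cases "x \<in> none_on m M M")
  case False
  then obtain t where t: "t < M" "all_on m t x" using x by (auto simp: none_on_def)
  have "determines (M * m) (tribes m M) (tribe m t) x"
    unfolding determines_iff[OF x] using t by (auto simp: tribes_def all_on_def)
  from witness_at_le[OF tribe_subset[OF t(1)] this] False show ?thesis by simp
next
  case True
  then have "\<forall>t\<in>{..<M}. \<exists>i. i \<in> tribe m t \<and> \<not> x i" by (auto simp: none_on_def all_on_def)
  then obtain z where z: "\<And>t. t < M \<Longrightarrow> z t \<in> tribe m t \<and> \<not> x (z t)" by (metis lessThan_iff)
  have "determines (M * m) (tribes m M) (z ` {..<M}) x"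
    unfolding determines_iff[OF x]
  proof (intro ballI impI)
    fix y assume y: "\<forall>i\<in>z ` {..<M}. y i = x i"
    have "\<not> tribes m M y" "\<not> tribes m M x" using y z by (auto simp: tribes_def all_on_def)
    then show "tribes m M y = tribes m M x" by simp
  qed
  moreover have "z ` {..<M} \<subseteq> {1..M * m}" using z tribe_subset by blast
  ultimately have "witness_at (M * m) (tribes m M) x \<le> card (z ` {..<M})" by (intro witness_at_le)
  also have "\<dots> \<le> M" using card_image_le[of "{..<M}" z] by simp
  finally show ?thesis using True by simp
qed

lemma witness_compl_tribes_le:
  "witness_compl (M * m) (tribes m M) \<le> m + M * (card (none_on m M M) / 2 ^ (M * m))"
proof -
  let ?C = "bitcube (M * m)" and ?Z = "none_on m M M"
  have "(\<Sum>x\<in>?C. real (witness_at (M * m) (tribes m M) x))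
      \<le> (\<Sum>x\<in>?C. real m + (if x \<in> ?Z then real M else 0))"
  proof (rule sum_mono)
    fix x assume "x \<in> ?C"
    from witness_at_tribes_le[OF this] 
    show "real (witness_at (M * m) (tribes m M) x) \<le> real m + (if x \<in> ?Z then real M else 0)"
      by (simp split: if_splits)
  qed
  also have "\<dots> = m * 2 ^ (M * m) + M * card ?Z"
    by (simp add: sum.distrib sum.If_cases none_on_def Int_def)
  finally have "(\<Sum>x\<in>?C. real (witness_at (M * m) (tribes m M) x)) / 2 ^ (M * m)
      \<le> (m * 2 ^ (M * m) + M * card ?Z) / 2 ^ (M * m)"
    by (intro divide_right_mono) simp_all
  then show ?thesis
    by (simp add: witness_compl_def expectation_pi_half add_divide_distrib)
qed

lemma witness_compl_pos:
  assumes "u \<in> bitcube N" "v \<in> bitcube N" "f u \<noteq> f v"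
  shows "0 < witness_compl N f"
proof -
  have "0 < witness_at N f u"
  proof (rule ccontr)
    assume w: "\<not> 0 < witness_at N f u"
    obtain W where W: "W \<subseteq> {1..N}" "determines N f W u" "card W = witness_at N f u"
      using witness_at_attained[OF assms(1)] .
    then have "W = {}" using w finite_subset[of W "{1..N}"] by simp
    then have "f v = f u"
      by (intro W(2)[unfolded determines_iff[OF assms(1)], rule_format] assms(2)) simp
    then show False using assms(3) by simp
  qed
  then have "0 < (\<Sum>x\<in>bitcube N. real (witness_at N f x))"
    using assms(1) by (intro sum_pos2[of _ u]) auto
  then show ?thesis by (simp add: witness_compl_def expectation_pi_half)
qed

text \<open>Bernoulli's inequality gives 1/2 for the exponent \<open>h\<close>; squaring gives the claim.\<close>

lemma one_minus_inverse_power_ge: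
  assumes "0 < h"
  shows "1 / 4 \<le> (1 - 1 / real (2 * h)) ^ (2 * h)"
proof -
  have "1 + real h * (- 1 / real (2 * h)) \<le> (1 + (- 1 / real (2 * h))) ^ h"
    by (rule Bernoulli_inequality) (use assms in \<open>simp add: field_simps\<close>)
  then have "1 / 2 \<le> (1 - 1 / real (2 * h)) ^ h" using assms by simp
  then have "(1 / 2) ^ 2 \<le> ((1 - 1 / real (2 * h)) ^ h) ^ 2" by (intro power_mono) auto
  then show ?thesis by (simp add: power_divide flip: power_mult) (simp add: mult.commute)
qed

text \<open>Write \<open>P\<close> for the probability that no tribe is on. With \<open>n * 2 ^ m\<close> tribes of width \<open>m\<close>, exactly
  one is on with probability at least \<open>n * P\<close>, which multiplies the local witness complexity by
  \<open>n\<close> compared to the contribution \<open>M * P\<close> of the inputs without tribes on to the witness complexity.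
  The width \<open>m = 2 * n\<close> makes \<open>M * P\<close> at least \<open>n\<close>, so that the witnesses of size \<open>m\<close> of the
  remaining inputs add only a constant factor.\<close>

lemma local_over_witness_tribes:
  "LIM n sequentially. local_witness_compl (n * 4 ^ n * (2 * n)) (tribes (2 * n) (n * 4 ^ n))
     / witness_compl (n * 4 ^ n * (2 * n)) (tribes (2 * n) (n * 4 ^ n)) :> at_top"
proof (rule filterlim_at_top_mono)
  show "LIM n sequentially. (1 / 6 * real n) :> at_top"
    by (intro filterlim_tendsto_pos_mult_at_top[OF tendsto_const] filterlim_real_sequentially) simp
  show "\<forall>\<^sub>F n in sequentially. 1 / 6 * real n
    \<le> local_witness_compl (n * 4 ^ n * (2 * n)) (tribes (2 * n) (n * 4 ^ n))
     / witness_compl (n * 4 ^ n * (2 * n)) (tribes (2 * n) (n * 4 ^ n))"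
  proof (rule eventually_sequentiallyI[of 1])
    fix n :: nat assume n: "1 \<le> n"
    define m where "m = 2 * n"
    define M where "M = n * 4 ^ n"
    define P where "P = card (none_on m M M) / 2 ^ (M * m)"
    let ?l = "local_witness_compl (M * m) (tribes m M)" and ?w = "witness_compl (M * m) (tribes m M)"
    have pm: "(2::real) ^ m = 4 ^ n" by (simp add: m_def power_mult)
    have m0: "0 < m" and M0: "0 < M" using n by (simp_all add: m_def M_def)
    have P: "(1 / 4) ^ n \<le> P"
    proof -
      have "1 / 4 \<le> (1 - 1 / real (2 * (2 * 4 ^ (n - 1)))) ^ (2 * (2 * 4 ^ (n - 1)))"
        by (rule one_minus_inverse_power_ge) simp
      moreover have eq: "2 * (2 * 4 ^ (n - 1)) = (4::nat) ^ n" using n by (cases n) auto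
      ultimately have "1 / 4 \<le> (1 - 1 / real (4 ^ n)) ^ 4 ^ n" unfolding eq by blast
      then have "1 / 4 \<le> (1 - 1 / (4::real) ^ n) ^ 4 ^ n" by simp
      then have "(1 / 4) ^ n \<le> ((1 - 1 / (4::real) ^ n) ^ 4 ^ n) ^ n" by (intro power_mono) auto
      also have "\<dots> = (1 - 1 / 2 ^ m) ^ M" by (simp add: pm M_def mult.commute flip: power_mult)
      also have "\<dots> \<le> P"
        unfolding P_def using card_none_on_ge[of M M m] by (simp add: pos_le_divide_eq)
      finally show ?thesis .
    qed
    have "real n = real M * (1 / 4) ^ n" by (simp add: M_def power_divide)
    also have "\<dots> \<le> M * P" using P by (intro mult_left_mono) auto
    finally have MP: "real n \<le> M * P" .
    have "?w \<le> real m + M * P" unfolding P_def by (rule witness_compl_tribes_le)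
    then have w: "?w \<le> 3 * (M * P)" using MP by (simp add: m_def)
    have w0: "0 < ?w"
    proof (rule witness_compl_pos)
      have "\<not> all_on m t (bits_of (M * m) {})" if "t < M" for t
      proof -
        have "t * m + 1 \<in> tribe m t" using m0 by (simp add: tribe_def)
        moreover from this have "t * m + 1 \<in> {1..M * m}" using tribe_subset[OF that] by blast
        ultimately show ?thesis by (force simp: all_on_def)
      qed
      then have "\<not> tribes m M (bits_of (M * m) {})" by (auto simp: tribes_def)
      moreover have "all_on m 0 (bits_of (M * m) {1..M * m})"
        using tribe_subset[OF M0, of m] by (auto simp: all_on_def)
      then have "tribes m M (bits_of (M * m) {1..M * m})" using M0 by (auto simp: tribes_def)
      ultimately show "tribes m M (bits_of (M * m) {1..M * m}) \<noteq> tribes m M (bits_of (M * m) {})" by simp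
    qed simp_all
    have "real n * (M * P) / 2 = M / 2 * (\<Sum>t<M. real (card (none_on m M M)) / 4 ^ n) / 2 ^ (M * m)"
      by (simp add: P_def M_def mult_ac)
    also have "\<dots> \<le> M / 2 * (\<Sum>t<M. real (card (only_on m M t))) / 2 ^ (M * m)"
    proof (intro divide_right_mono mult_left_mono sum_mono)
      fix t assume "t \<in> {..<M}"
      then have "real (card (none_on m M M)) \<le> real (card (only_on m M t) * 2 ^ m)"
        using card_none_on_le by (simp only: of_nat_le_iff lessThan_iff)
      then show "real (card (none_on m M M)) / 4 ^ n \<le> real (card (only_on m M t))"
        by (simp add: pm pos_divide_le_eq)
    qed simp_all
    also have "\<dots> \<le> ?l" by (rule local_witness_compl_tribes_ge[OF m0])
    finally have l: "real n * (M * P) / 2 \<le> ?l" .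
    have "1 / 6 * real n * ?w \<le> 1 / 6 * real n * (3 * (M * P))"
      by (intro mult_left_mono w) simp
    also have "\<dots> \<le> ?l" using l by (simp add: mult_ac)
    finally have "1 / 6 * real n \<le> ?l / ?w" using w0 by (simp only: pos_le_divide_eq)
    then show "1 / 6 * real n
    \<le> local_witness_compl (n * 4 ^ n * (2 * n)) (tribes (2 * n) (n * 4 ^ n))
     / witness_compl (n * 4 ^ n * (2 * n)) (tribes (2 * n) (n * 4 ^ n))"
      by (simp only: m_def M_def)
  qed
qed

theorem theorem5p3:
  shows "(\<exists>(N :: nat \<Rightarrow> nat) (f :: nat \<Rightarrow> bits \<Rightarrow> bool).
            LIM n sequentially. local_witness_compl (N n) (f n) / witness_compl (N n) (f n) :> at_top)
       \<and> (\<exists>(N :: nat \<Rightarrow> nat) (f :: nat \<Rightarrow> bits \<Rightarrow> bool).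
            LIM n sequentially. witness_compl (N n) (f n) / block_sens (N n) (f n) :> at_top)
       \<and> (\<exists>(N :: nat \<Rightarrow> nat) (f :: nat \<Rightarrow> bits \<Rightarrow> bool).
            LIM n sequentially. block_sens (N n) (f n) / sens (N n) (f n) :> at_top)"
  by (intro conjI exI)
    (rule local_over_witness_tribes witness_over_block_sens_more_ones_than
      block_sens_over_sens_all_ones)+

end
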